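(* Let $H$ be a finite, connected $(d,r)$-regular hypergraph with $d\ge r$, and let $q=(d-1)(r-1)$. Then $\zeta_H(q^{-s})$ satisfies the modified hypergraph Riemann hypothesis if and only if $H$ is a Ramanujan hypergraph.
   Context: A hypergraph $H=(V,E)$ consists of a set $V$ of hypervertices and a family $E$ of hyperedges, each a nonempty subset of $V$, with union $V$; repeated hyperedges are allowed and count as distinct elements of $E$. $H$ is $(d,r)$-regular if every hypervertex is in exactly $d$ hyperedges and every hyperedge contains exactly $r$ hypervertices. The associated bipartite graph $B_H$ has vertex set $V\sqcup E$, with $v$ adjacent to $e$ iff $v\in e$; $H$ is connected if $B_H$ is. Put $n_1=|V|$, $n_2=|E|$. The adjacency matrix $A$ of $H$ is indexed by $V$; its $(v,w)$ entry is the number of paths of length $2$ without backtracking from $v$ to $w$ in $B_H$ (so it is $0$ if $v=w$, and the number of hyperedges containing both $v$ and $w$ if $v\neq w$). $\mathrm{Spec}(H)$ is the spectrum of $A$; $d(r-1)$ is its largest eigenvalue. When $d<r$, the eigenvalue $-d$ of $H$ occurring with multiplicity at least $|V|-|E|$ is called obvious; when $d\ge r$, $H$ has no obvious eigenvalues. A finite, connected $(d,r)$-regular hypergraph $H$ is Ramanujan if $|\lambda-r+2|\le 2\sqrt{(d-1)(r-1)}$ for all non-obvious eigenvalues $\lambda\in \mathrm{Spec}(H)$ with $\lambda\ne d(r-1)$. A closed path of length $k\ge 1$ in $H$ is a sequence $c=(v_1,e_1,\dots,v_k,e_k,v_1)$ with $v_i\in e_{i-1}\cap e_i$ and $v_i\ne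 v_{i+1}$ for all $i\in\mathbb Z/k\mathbb Z$. It has hyperedge backtracking if it contains consecutive entries $(e,v,e)$. $c^m$ is $c$ traversed $m$ times; $c$ is tail-less if $c^2$ has no hyperedge backtracking. A primitive cycle is a closed path without hyperedge backtracking, tail-less, and not of the form $b^m$ with $m\ge2$, $b$ a closed path. Prime cycles $\mathfrak p$ are equivalence classes of primitive cycles under cyclic permutation, of length $|\mathfrak p|$. For $|u|$ sufficiently small, $\zeta_H(u)=\prod_{\mathfrak p}(1-u^{|\mathfrak p|})^{-1}$, the product over all prime cycles; $\zeta_H$ continues to a rational function on $\mathbb C$ (the inverse of a polynomial), also denoted $\zeta_H$. Modified hypergraph Riemann hypothesis: for every $s\in\mathbb C$ with $\mathrm{Re}\, s\in(0,1)$, $$\frac{(1+(r-1)q^{-s})^{\,n_1-n_2}}{\zeta_H(q^{-s})}=0\ \Longrightarrow\ \mathrm{Re}\, s=\tfrac12,$$ where the left side is understood as a rational function of $u=q^{-s}$ after cancellation of common factors.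
   Formalization: Two cases are excluded: q = 1 (d = r = 2, cycles: Ramanujan, but the Riemann hypothesis fails), and r = 2 with H a bipartite graph (there -d breaks the Ramanujan bound, yet the Riemann hypothesis can hold, e.g. for K_{3,3}). *)

theory Defs
  imports
    "HOL-Computational_Algebra.Computational_Algebra"
    "HOL-Computational_Algebra.Field_as_Ring"
    "HOL-Analysis.Analysis"
    "Graph_Theory.Graph_Theory"
    "Jordan_Normal_Form.Spectral_Radius"
begin

text \<open>
  Hyperedges are labels; \<open>ends H e\<close> is the set of hypervertices of the hyperedge \<open>e\<close>.
  Distinct labels may have equal sets, which is how repeated hyperedges arise.
\<close>

record ('v, 'e) hypergraph =
  hverts :: "'v set"
  hedges :: "'e set"
  ends :: "'e \<Rightarrow> 'v set"

definition is_hypergraph :: "('v, 'e) hypergraph \<Rightarrow> bool" where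
  "is_hypergraph H \<longleftrightarrow> (\<forall>e\<in>hedges H. ends H e \<noteq> {}) \<and> (\<Union>e\<in>hedges H. ends H e) = hverts H"

definition finite_hypergraph :: "('v, 'e) hypergraph \<Rightarrow> bool" where
  "finite_hypergraph H \<longleftrightarrow> is_hypergraph H \<and> finite (hverts H) \<and> finite (hedges H)"

definition regular_hypergraph :: "nat \<Rightarrow> nat \<Rightarrow> ('v, 'e) hypergraph \<Rightarrow> bool" where
  "regular_hypergraph d r H \<longleftrightarrow>
     (\<forall>v\<in>hverts H. card {e \<in> hedges H. v \<in> ends H e} = d) \<and>
     (\<forall>e\<in>hedges H. card (ends H e) = r)"

definition bip_graph :: "('v, 'e) hypergraph \<Rightarrow> ('v + 'e) pair_pre_digraph" where
  "bip_graph H =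
     \<lparr> pverts = hverts H <+> hedges H,
       parcs = (\<Union>e\<in>hedges H. \<Union>v\<in>ends H e. {(Inl v, Inr e), (Inr e, Inl v)}) \<rparr>"

definition connected_hypergraph :: "('v, 'e) hypergraph \<Rightarrow> bool" where
  "connected_hypergraph H \<longleftrightarrow> Digraph_Component.connected (with_proj (bip_graph H))"

text \<open>
  No hyperedge is monochromatic; for \<open>r = 2\<close> this says that \<open>H\<close> is a bipartite graph. Then \<open>-d\<close>
  is an eigenvalue, and for \<open>d \<ge> 3\<close> it violates the bound in \<open>ramanujan\<close> below, while its zeros
  \<open>u = -1\<close> and \<open>u = -1/q\<close> have \<open>Re s = 0\<close> and \<open>Re s = 1\<close>, outside the open critical strip.
\<close>

definition two_colorable :: "('v, 'e) hypergraph \<Rightarrow> bool" where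
  "two_colorable H \<longleftrightarrow>
     (\<exists>col :: 'v \<Rightarrow> bool. \<forall>e\<in>hedges H. \<exists>v\<in>ends H e. \<exists>w\<in>ends H e. col v \<noteq> col w)"


subsection \<open>Adjacency matrix and Ramanujan hypergraphs\<close>

text \<open>
  A path \<open>Inl v, x, Inl w\<close> of length 2 is determined by its middle vertex \<open>x\<close>; it backtracks
  iff \<open>v = w\<close>.
\<close>

definition adj_entry :: "('v, 'e) hypergraph \<Rightarrow> 'v \<Rightarrow> 'v \<Rightarrow> nat" where
  "adj_entry H v w =
     card {x. (Inl v, x) \<in> parcs (bip_graph H) \<and> (x, Inl w) \<in> parcs (bip_graph H) \<and> v \<noteq> w}"

lemma adj_entry_eq:
  "adj_entry H v w = (if v = w then 0 else card {e \<in> hedges H. v \<in> ends H e \<and> w \<in> ends H e})"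
proof (cases "v = w")
  case False
  have "{x. (Inl v, x) \<in> parcs (bip_graph H) \<and> (x, Inl w) \<in> parcs (bip_graph H) \<and> v \<noteq> w}
      = Inr ` {e \<in> hedges H. v \<in> ends H e \<and> w \<in> ends H e}"
    using False by (auto simp: bip_graph_def)
  with False show ?thesis
    by (simp add: adj_entry_def card_image)
qed (simp add: adj_entry_def)

text \<open>
  Library matrices are indexed by \<open>{0..<n}\<close>, so \<open>V\<close> has to be enumerated. The spectrum does not
  depend on the enumeration chosen.
\<close>

definition vert_list :: "('v, 'e) hypergraph \<Rightarrow> 'v list" where
  "vert_list H = (SOME vs. distinct vs \<and> set vs = hverts H)"

definition adj_matrix :: "('v, 'e) hypergraph \<Rightarrow> complex mat" where
  "adj_matrix H =
     Matrix.mat (card (hverts H)) (card (hverts H))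
       (\<lambda>(i, j). of_nat (adj_entry H (vert_list H ! i) (vert_list H ! j)))"

definition Spec :: "('v, 'e) hypergraph \<Rightarrow> complex set" where
  "Spec H = spectrum (adj_matrix H)"

definition obvious_eigenvalues :: "nat \<Rightarrow> nat \<Rightarrow> complex set" where
  "obvious_eigenvalues d r = (if d < r then {- of_nat d} else {})"

definition ramanujan :: "nat \<Rightarrow> nat \<Rightarrow> ('v, 'e) hypergraph \<Rightarrow> bool" where
  "ramanujan d r H \<longleftrightarrow>
     finite_hypergraph H \<and> connected_hypergraph H \<and> regular_hypergraph d r H \<and>
     (\<forall>x \<in> Spec H - obvious_eigenvalues d r.
        x \<noteq> of_nat d * (of_nat r - 1) \<longrightarrow>
        cmod (x - of_nat r + 2) \<le> 2 * sqrt ((real d - 1) * (real r - 1)))"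


subsection \<open>Prime cycles and the zeta function\<close>

text \<open>
  The closed path \<open>(v\<^sub>1, e\<^sub>1, \<dots>, v\<^sub>k, e\<^sub>k, v\<^sub>1)\<close> is the list \<open>[(v\<^sub>1, e\<^sub>1), \<dots>, (v\<^sub>k, e\<^sub>k)]\<close>. Indices in
  \<^term>\<open>closed_path H\<close> are cyclic, whereas backtracking only concerns entries that are consecutive
  in the sequence itself, so \<open>e\<^sub>k = e\<^sub>1\<close> does not count as backtracking in \<open>c\<close> but does in \<open>c\<^sup>2\<close>.
\<close>

definition closed_path :: "('v, 'e) hypergraph \<Rightarrow> ('v \<times> 'e) list \<Rightarrow> bool" where
  "closed_path H c \<longleftrightarrow> c \<noteq> [] \<and>
     (\<forall>i < length c.
        let (v, e) = c ! i; (w, f) = c ! (Suc i mod length c) in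
          v \<in> hverts H \<and> e \<in> hedges H \<and> v \<in> ends H e \<and> w \<in> ends H e \<and> v \<noteq> w)"

definition path_power :: "('v \<times> 'e) list \<Rightarrow> nat \<Rightarrow> ('v \<times> 'e) list" where
  "path_power c m = concat (replicate m c)"

definition hyperedge_backtracking :: "('v \<times> 'e) list \<Rightarrow> bool" where
  "hyperedge_backtracking c \<longleftrightarrow> (\<exists>i. Suc i < length c \<and> snd (c ! i) = snd (c ! Suc i))"

definition tailless :: "('v \<times> 'e) list \<Rightarrow> bool" where
  "tailless c \<longleftrightarrow> \<not> hyperedge_backtracking (path_power c 2)"

definition primitive_cycle :: "('v, 'e) hypergraph \<Rightarrow> ('v \<times> 'e) list \<Rightarrow> bool" where
  "primitive_cycle H c \<longleftrightarrow>
     closed_path H c \<and> \<not> hyperedge_backtracking c \<and> tailless c \<and>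
     \<not> (\<exists>b m. closed_path H b \<and> m \<ge> 2 \<and> c = path_power b m)"

definition prime_cycles :: "('v, 'e) hypergraph \<Rightarrow> ('v \<times> 'e) list set set" where
  "prime_cycles H =
     {c. primitive_cycle H c} //
     {(b, c). primitive_cycle H b \<and> primitive_cycle H c \<and> (\<exists>n. c = rotate n b)}"

definition cycle_length :: "('v \<times> 'e) list set \<Rightarrow> nat" where
  "cycle_length p = length (SOME c. c \<in> p)"

text \<open>
  The value of the (generally infinite) Euler product is the limit of its finite partial
  products along the directed set of finite sets of primes, as for \<^const>\<open>has_sum\<close>.
\<close>

definition euler_product :: "('v, 'e) hypergraph \<Rightarrow> complex \<Rightarrow> complex \<Rightarrow> bool" where
  "euler_product H u z \<longleftrightarrow>
     ((\<lambda>P. \<Prod>p\<in>P. inverse (1 - u ^ cycle_length p)) \<longlongrightarrow> z)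
       (finite_subsets_at_top (prime_cycles H))"

text \<open>
  Rational functions are elements of \<^typ>\<open>complex poly fract\<close>; \<^const>\<open>quot_of_fract\<close> gives
  numerator and denominator in lowest terms.
\<close>

definition rf_pole :: "complex poly fract \<Rightarrow> complex \<Rightarrow> bool" where
  "rf_pole R u \<longleftrightarrow> poly (snd (quot_of_fract R)) u = 0"

definition rf_eval :: "complex poly fract \<Rightarrow> complex \<Rightarrow> complex" where
  "rf_eval R u = poly (fst (quot_of_fract R)) u / poly (snd (quot_of_fract R)) u"

definition rf_vanishes :: "complex poly fract \<Rightarrow> complex \<Rightarrow> bool" where
  "rf_vanishes R u \<longleftrightarrow> \<not> rf_pole R u \<and> rf_eval R u = 0"

text \<open>The unique rational function that agrees with the Euler product near 0.\<close>

definition zeta :: "('v, 'e) hypergraph \<Rightarrow> complex poly fract" where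
  "zeta H =
     (THE Z. \<exists>\<epsilon>>0. \<forall>u. cmod u < \<epsilon> \<longrightarrow> \<not> rf_pole Z u \<and> euler_product H u (rf_eval Z u))"

text \<open>
  For \<open>q = 1\<close>, i.e. \<open>d = r = 2\<close>, \<open>q\<^sup>-\<^sup>s\<close> is constantly 1, a zero of the quotient, so the condition
  fails. For \<open>q = 0\<close>, i.e. \<open>r = 1\<close> or \<open>d = 1\<close>, \<open>q\<^sup>-\<^sup>s\<close> is read as 0.
\<close>

definition modified_RH :: "('v, 'e) hypergraph \<Rightarrow> nat \<Rightarrow> real \<Rightarrow> bool" where
  "modified_RH H r q \<longleftrightarrow>
     (\<forall>s :: complex. 0 < Re s \<and> Re s < 1 \<longrightarrow>
        rf_vanishes
          (to_fract [:1, of_nat r - 1:] powi (int (card (hverts H)) - int (card (hedges H))) / zeta H)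
          (of_real q powr (- s))
        \<longrightarrow> Re s = 1 / 2)"

end

theory Submission
  imports Defs
begin

text \<open>
  Both sides of the equivalence are read off from one factorization. Let \<open>n\<^sub>1\<close>, \<open>n\<^sub>2\<close> and \<open>N\<close> be the
  numbers of hypervertices, hyperedges and flags (incident pairs), so that \<open>N = n\<^sub>1 d = n\<^sub>2 r\<close>. Then
  \[ (1 + (r - 1) u)^{n_1 - n_2} / \zeta_H(u)
     = (1 - u)^{N - n_1 - n_2} \prod_\lambda (1 - (\lambda - r + 2) u + q u^2), \]
  where \<open>\<lambda>\<close> runs through the eigenvalues of the adjacency matrix with multiplicity
  (\<open>zeta_quotient_eq_poly\<close>).

  The factorization has two halves. The first is valid for every finite hypergraph. A closed path
  without backtracking and tail is a closed walk of the relation \<open>flag_step\<close> on flags, and such walks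
  are exactly the powers \<open>c\<^sup>m\<close> of primitive cycles, in a unique way. Hence the logarithm of the Euler
  product is \<open>\<Sum>w. u\<^bsup>|w|\<^esup> / |w|\<close> over all these walks. They are counted by the traces of the powers of
  the transition matrix \<open>T\<close> of \<open>flag_step\<close>, so the sum is \<open>- log det (1 - u T)\<close>
  (\<open>euler_product_eq_inverse_det\<close>). The second half evaluates this determinant. If \<open>P\<close> and \<open>Q\<close> are the
  0-1 matrices of "same hyperedge" and "same hypervertex" on flags, then \<open>T = (P - 1) (Q - 1)\<close>. Both
  \<open>P\<close> and \<open>Q\<close> factor through a smaller space, the functions on hyperedges and on hypervertices, and
  \<open>det (1 + X Y) = det (1 + Y X)\<close> moves the determinant there (\<open>det_flag_step_matrix\<close>).

  If \<open>r \<ge> 2\<close>, then \<open>q > 1\<close>, and it remains to look at zeros in the annulus \<open>1/q < |u| < 1\<close>,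
  the image of the open critical strip under \<open>s \<mapsto> q\<^bsup>-s\<^esup>\<close>. For real \<open>\<mu> = \<lambda> - r + 2\<close>, the two roots of \<open>1 - \<mu> u + q u\<^sup>2\<close> have product \<open>1/q\<close>.
  They have modulus \<open>q\<^bsup>-1/2\<^esup>\<close> if \<open>|\<mu>| \<le> 2 \<surd>q\<close>, and are real with different moduli
  otherwise; in the latter case they lie in the annulus iff \<open>|\<mu>| < 1 + q\<close>. The eigenvalue \<open>d (r - 1)\<close>
  has \<open>\<mu> = 1 + q\<close> and the roots \<open>1\<close> and \<open>1/q\<close> on the boundary of the annulus. So everything follows once
  all other eigenvalues satisfy \<open>|\<mu>| < 1 + q\<close>. This comes from \<open>0 \<le> A + d \<le> d r\<close>, which holds because
  \<open>A + d = M M\<^sup>T\<close>, where the incidence matrix \<open>M\<close> has \<open>d\<close> ones in each row and \<open>r\<close> in each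
  column. Only \<open>\<lambda> = - d\<close> with \<open>r = 2\<close> could violate it, and then the signs of an eigenfunction colour
  \<open>H\<close> with two colours (\<open>two_colorable_if_minus_degree_eigenvalue\<close>). For \<open>r = 1\<close> there are no cycles
  and \<open>A = 0\<close>, so both sides hold.
\<close>

hide_const (open) Determinants.det

section \<open>Periods and primitive words\<close>

text \<open>
  The list is read cyclically, so that \<open>p\<close> may exceed the length and every multiple of the length is
  a period.
\<close>

definition cyc_period :: "'a list \<Rightarrow> nat \<Rightarrow> bool" where
  "cyc_period c p \<longleftrightarrow> (\<forall>i. c ! ((i + p) mod length c) = c ! (i mod length c))"

text \<open>
  The part of the notion of a primitive cycle that does not refer to the hypergraph: a root of a
  closed walk is again a closed walk, so it does not matter where the roots are taken.
\<close>

definition primitive_word :: "('v \<times> 'e) list \<Rightarrow> bool" where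
  "primitive_word c \<longleftrightarrow> c \<noteq> [] \<and> \<not> (\<exists>b m. m \<ge> 2 \<and> c = path_power b m)"

lemma path_power_0 [simp]: "path_power b 0 = []"
  and path_power_1 [simp]: "path_power b (Suc 0) = b"
  and path_power_Suc: "path_power b (Suc m) = b @ path_power b m"
  by (simp_all add: path_power_def)

lemma path_power_add: "path_power b (m + n) = path_power b m @ path_power b n"
  by (simp add: path_power_def replicate_add)

lemma path_power_mult: "path_power (path_power b k) m = path_power b (k * m)"
  by (induction m) (simp_all add: path_power_Suc path_power_add)

lemma length_path_power [simp]: "length (path_power b m) = m * length b"
  by (induction m) (simp_all add: path_power_Suc)

lemma path_power_eq_Nil_iff [simp]: "path_power b m = [] \<longleftrightarrow> b = [] \<or> m = 0"
  by (cases m) (auto simp: path_power_def)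

lemma nth_path_power: "i < m * length b \<Longrightarrow> path_power b m ! i = b ! (i mod length b)"
proof (induction m arbitrary: i)
  case (Suc m)
  show ?case
  proof (cases "i < length b")
    case False
    with Suc have "path_power b m ! (i - length b) = b ! ((i - length b) mod length b)"
      by (intro Suc.IH) auto
    with False show ?thesis by (simp add: path_power_Suc nth_append le_mod_geq)
  qed (simp add: path_power_Suc nth_append)
qed simp

lemma nth_path_power_mod:
  assumes "b \<noteq> []" "m > 0"
  shows "path_power b m ! (i mod (m * length b)) = b ! (i mod length b)"
  using assms by (subst nth_path_power) (auto simp: mod_mod_cancel)

lemma cyc_period_path_power: "b \<noteq> [] \<Longrightarrow> m > 0 \<Longrightarrow> cyc_period (path_power b m) (length b)"
  by (simp add: cyc_period_def nth_path_power_mod)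

lemma cyc_period_mult: "cyc_period c p \<Longrightarrow> cyc_period c (k * p)"
proof (induction k)
  case (Suc k)
  have "c ! ((i + (p + k * p)) mod length c) = c ! (i mod length c)" for i
  proof -
    have "c ! ((i + p + k * p) mod length c) = c ! ((i + p) mod length c)"
      using Suc.IH[OF Suc.prems] unfolding cyc_period_def by blast
    also have "\<dots> = c ! (i mod length c)" using Suc.prems unfolding cyc_period_def by blast
    finally show ?thesis by (simp add: add.assoc)
  qed
  thus ?case by (simp add: cyc_period_def)
qed (simp add: cyc_period_def)

text \<open>
  By Bezout, the greatest common divisor is a difference of multiples of the two periods.
\<close>

lemma cyc_period_gcd:
  assumes "c \<noteq> []" "cyc_period c p" "cyc_period c p'" "p > 0"
  shows "cyc_period c (gcd p p')"
proof -
  obtain x y where xy: "p * x = p' * y + gcd p p'"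
    using bezout_nat[of p p'] assms(4) by auto
  have "c ! ((i + gcd p p') mod length c) = c ! (i mod length c)" for i
  proof -
    have "c ! ((i + gcd p p') mod length c) = c ! ((i + gcd p p' + y * p') mod length c)"
      using cyc_period_mult[OF assms(3), of y] unfolding cyc_period_def by metis
    also have "i + gcd p p' + y * p' = i + x * p" using xy by (simp add: ac_simps)
    also have "c ! ((i + x * p) mod length c) = c ! (i mod length c)"
      using cyc_period_mult[OF assms(2), of x] unfolding cyc_period_def by metis
    finally show ?thesis .
  qed
  thus ?thesis by (simp add: cyc_period_def)
qed

lemma cyc_period_length: "cyc_period c (length c)"
  by (simp add: cyc_period_def)

lemma path_power_of_period:
  assumes "c \<noteq> []" "cyc_period c g" "g dvd length c"
  shows "c = path_power (take g c) (length c div g)"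
proof -
  have g: "g > 0" "g \<le> length c" using assms by (auto simp: dvd_imp_le intro: gr0I)
  hence lt: "length (take g c) = g" by simp
  show ?thesis
  proof (rule nth_equalityI)
    show len: "length c = length (path_power (take g c) (length c div g))"
      using assms(3) lt by simp
    fix i assume i: "i < length c"
    have "c ! i = c ! ((i mod g + (i div g) * g) mod length c)" using i by simp
    also have "\<dots> = c ! ((i mod g) mod length c)"
      using cyc_period_mult[OF assms(2), of "i div g"] unfolding cyc_period_def by metis
    also have "(i mod g) mod length c = i mod g" using g i by (meson mod_less mod_less_divisor order_less_le_trans)
    also have "c ! (i mod g) = take g c ! (i mod length (take g c))" using g lt by simp
    also have "\<dots> = path_power (take g c) (length c div g) ! i"
      using i len by (subst nth_path_power) auto
    finally show "c ! i = path_power (take g c) (length c div g) ! i" .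
  qed
qed

text \<open>
  The greatest common divisor of a period and the length is a period dividing the length, and a
  period dividing the length exhibits the word as a power.
\<close>

lemma primitive_word_period:
  assumes "primitive_word c" "cyc_period c p"
  shows "length c dvd p"
proof (cases "p = 0")
  case False
  let ?l = "length c" and ?g = "gcd p (length c)"
  have c: "c \<noteq> []" using assms(1) by (simp add: primitive_word_def)
  have "c = path_power (take ?g c) (?l div ?g)"
    using False by (intro path_power_of_period cyc_period_gcd c assms(2) cyc_period_length) auto
  hence "\<not> ?l div ?g \<ge> 2" using assms(1) unfolding primitive_word_def by metis
  moreover have "?l div ?g > 0" using c by (simp add: div_greater_zero_iff)
  ultimately have "?l div ?g = 1" by linarith
  hence "?l = ?g" by (metis dvd_div_mult_self gcd_dvd2 mult_1)
  thus ?thesis by (metis gcd_dvd1)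
qed simp

lemma primitive_wordI:
  assumes "c \<noteq> []" "\<And>p. cyc_period c p \<Longrightarrow> length c dvd p"
  shows "primitive_word c"
  unfolding primitive_word_def
proof (rule conjI[OF assms(1)], rule notI)
  assume "\<exists>b m. 2 \<le> m \<and> c = path_power b m"
  then obtain b m where m: "2 \<le> m" and eq: "c = path_power b m" by blast
  have "b \<noteq> []" using assms(1) eq by auto
  hence "length c dvd length b" using assms(2)[of "length b"] cyc_period_path_power[of b m] eq m by simp
  with \<open>b \<noteq> []\<close> m eq show False by (auto dest!: dvd_imp_le)
qed

lemma primitive_root_exists:
  assumes "c \<noteq> []"
  obtains b m where "primitive_word b" "m > 0" "c = path_power b m"
proof -
  have "\<exists>b m. primitive_word b \<and> m > 0 \<and> c = path_power b m"
    using assms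
  proof (induction "length c" arbitrary: c rule: less_induct)
    case less
    show ?case
    proof (cases "primitive_word c")
      case True
      thus ?thesis by (intro exI[of _ c] exI[of _ "Suc 0"]) simp
    next
      case False
      then obtain b m where bm: "m \<ge> 2" "c = path_power b m"
        using less.prems by (auto simp: primitive_word_def)
      hence "b \<noteq> []" "length b < length c" using less.prems by auto
      then obtain a k where "primitive_word a" "k > 0" "b = path_power a k"
        using less.hyps by blast
      thus ?thesis using bm by (intro exI[of _ a] exI[of _ "k * m"]) (auto simp: path_power_mult)
    qed
  qed
  thus ?thesis using that by blast
qed

text \<open>
  If \<open>b\<^sup>m = c\<^sup>n\<close> then \<open>|c|\<close> is a period of \<open>b\<close> and \<open>|b|\<close> one of \<open>c\<close>, so the lengths divide each other.
\<close>

lemma primitive_root_unique: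
  assumes "primitive_word b" "primitive_word c" "m > 0" "n > 0" "path_power b m = path_power c n"
  shows "b = c" "m = n"
proof -
  have dvd: "length b dvd length c"
    if "primitive_word b" "primitive_word c" "m > 0" "n > 0" "path_power b m = path_power c n"
    for b c :: "('a \<times> 'b) list" and m n
  proof -
    have "b \<noteq> []" "c \<noteq> []" using that by (auto simp: primitive_word_def)
    have "cyc_period (path_power b m) (length c)"
      using that cyc_period_path_power[OF \<open>c \<noteq> []\<close>] by simp
    hence "path_power b m ! ((i + length c) mod (m * length b)) = path_power b m ! (i mod (m * length b))" for i
      unfolding cyc_period_def by simp
    hence "cyc_period b (length c)"
      using nth_path_power_mod[OF \<open>b \<noteq> []\<close> \<open>m > 0\<close>] unfolding cyc_period_def by simp
    with that(1) show ?thesis by (rule primitive_word_period)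
  qed
  have ne: "b \<noteq> []" "c \<noteq> []" using assms by (auto simp: primitive_word_def)
  have len: "length b = length c" using dvd assms by (metis dvd_antisym)
  have "m * length b = n * length c" using assms(5) length_path_power by metis
  with len ne show "m = n" by simp
  show "b = c"
    using assms len ne by (metis append_eq_append_conv gr0_implies_Suc path_power_Suc)
qed

lemma nth_rotate_mod:
  assumes "c \<noteq> []"
  shows "rotate n c ! (i mod length c) = c ! ((i + n) mod length c)"
  using assms by (simp add: nth_rotate mod_add_left_eq add.commute mod_simps)

text \<open>
  Rotation does not change the periods, and these decide primitivity.
\<close>

lemma primitive_word_rotate:
  assumes "primitive_word c"
  shows "primitive_word (rotate n c)"
proof (rule primitive_wordI)
  have ne: "c \<noteq> []" using assms by (simp add: primitive_word_def)
  thus "rotate n c \<noteq> []" by simp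
  fix p assume "cyc_period (rotate n c) p"
  hence *: "c ! ((i + p + n) mod length c) = c ! ((i + n) mod length c)" for i
    using nth_rotate_mod[OF ne] unfolding cyc_period_def by simp
  have "cyc_period c p"
    unfolding cyc_period_def
  proof
    fix i
    \<comment> \<open>The index \<open>i - n\<close>, shifted by a multiple of the length to keep it
      nonnegative.\<close>
    let ?k = "n * length c - n + i"
    have "n \<le> n * length c" using ne by (cases c) auto
    hence "?k + n = i + n * length c" by linarith
    hence "?k + p + n = i + p + n * length c" "?k + n = i + n * length c" by linarith+
    with *[of ?k] show "c ! ((i + p) mod length c) = c ! (i mod length c)" by simp
  qed
  with assms show "length (rotate n c) dvd p" by (simp add: primitive_word_period)
qed

text \<open>
  Two equal rotations by \<open>i < j\<close> would give the period \<open>j - i\<close>, which is too short. Hence a prime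
  cycle of length \<open>l\<close> contains exactly \<open>l\<close> primitive cycles.
\<close>

lemma inj_on_rotate_primitive:
  assumes "primitive_word c"
  shows "inj_on (\<lambda>n. rotate n c) {..<length c}"
proof (rule linorder_inj_onI')
  fix i j assume ij: "i \<in> {..<length c}" "j \<in> {..<length c}" "i < j"
  have ne: "c \<noteq> []" using assms by (simp add: primitive_word_def)
  show "rotate i c \<noteq> rotate j c"
  proof
    assume "rotate i c = rotate j c"
    hence *: "c ! ((k + i) mod length c) = c ! ((k + j) mod length c)" for k
      using nth_rotate_mod[OF ne] by metis
    have "cyc_period c (j - i)"
      unfolding cyc_period_def
    proof
      fix k
      have "(k + length c - i + i) mod length c = k mod length c" using ij by simp
      moreover have "(k + length c - i + j) mod length c = (k + (j - i)) mod length c"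
      proof -
        have "k + length c - i + j = k + (j - i) + length c" using ij by simp
        thus ?thesis by (metis mod_add_self2)
      qed
      ultimately show "c ! ((k + (j - i)) mod length c) = c ! (k mod length c)"
        using *[of "k + length c - i"] by simp
    qed
    hence "length c dvd j - i" by (rule primitive_word_period[OF assms])
    with ij show False by (auto dest: dvd_imp_le)
  qed
qed

section \<open>Closed walks of a relation\<close>

definition cyclic_walk :: "('a \<Rightarrow> 'a \<Rightarrow> bool) \<Rightarrow> 'a list \<Rightarrow> bool" where
  "cyclic_walk R c \<longleftrightarrow> c \<noteq> [] \<and> (\<forall>i<length c. R (c ! i) (c ! (Suc i mod length c)))"

lemma cyclic_walk_iff:
  "cyclic_walk R c \<longleftrightarrow> c \<noteq> [] \<and> (\<forall>i. R (c ! (i mod length c)) (c ! (Suc i mod length c)))"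
proof -
  have "R (c ! (i mod length c)) (c ! (Suc i mod length c))"
    if "c \<noteq> []" "\<forall>i<length c. R (c ! i) (c ! (Suc i mod length c))" for i
    using that(2)[rule_format, of "i mod length c"] that(1) by (simp add: mod_Suc_eq)
  thus ?thesis unfolding cyclic_walk_def by (metis mod_less)
qed

lemma cyclic_walk_path_power:
  assumes "m > 0"
  shows "cyclic_walk R (path_power b m) \<longleftrightarrow> cyclic_walk R b"
  using assms by (cases "b = []") (simp_all add: cyclic_walk_iff nth_path_power_mod)

lemma cyclic_walk_rotate:
  assumes "cyclic_walk R c" shows "cyclic_walk R (rotate n c)"
  using assms nth_rotate_mod[of c] by (auto simp: cyclic_walk_iff)

section \<open>Eigenvalues, power traces and determinants\<close>

lemma upper_triangular_mult_index:
  fixes A B :: "'a :: comm_ring_1 mat"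
  assumes A: "A \<in> carrier_mat n n" and B: "B \<in> carrier_mat n n"
    and "upper_triangular A" "upper_triangular B" and ij: "i < n" "j \<le> i"
  shows "(A * B) $$ (i, j) = (if i = j then A $$ (i, i) * B $$ (i, i) else 0)"
proof -
  have "(A * B) $$ (i, j) = (\<Sum>k = 0..<n. A $$ (i, k) * B $$ (k, j))"
    using A B ij by (simp add: scalar_prod_def)
  also have "\<dots> = (\<Sum>k = 0..<n. if k = i \<and> i = j then A $$ (i, i) * B $$ (i, i) else 0)"
  proof (rule sum.cong[OF refl])
    fix k assume k: "k \<in> {0..<n}"
    show "A $$ (i, k) * B $$ (k, j) = (if k = i \<and> i = j then A $$ (i, i) * B $$ (i, i) else 0)"
    proof (cases "k = i")
      case False
      hence "k < i \<or> j < k" using ij by auto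
      hence "A $$ (i, k) = 0 \<or> B $$ (k, j) = 0"
        using upper_triangularD[OF assms(3), of k i] upper_triangularD[OF assms(4), of j k] assms k by auto
      with False show ?thesis by auto
    next
      case True
      show ?thesis
      proof (cases "i = j")
        case False
        hence "B $$ (i, j) = 0" using upper_triangularD[OF assms(4), of j i] B ij by auto
        with True False show ?thesis by simp
      qed (use True in simp)
    qed
  qed
  also have "\<dots> = (if i = j then A $$ (i, i) * B $$ (i, i) else 0)"
    using ij by (auto simp: sum.delta)
  finally show ?thesis .
qed

lemma upper_triangular_pow_index:
  fixes B :: "'a :: comm_ring_1 mat"
  assumes "B \<in> carrier_mat n n" "upper_triangular B" "i < n" "j \<le> i"
  shows "(B ^\<^sub>m k) $$ (i, j) = (if i = j then (B $$ (i, i)) ^ k else 0)"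
  using assms(3,4)
proof (induction k arbitrary: i j)
  case (Suc k)
  have Bk: "B ^\<^sub>m k \<in> carrier_mat n n" using assms(1) by simp
  moreover have "upper_triangular (B ^\<^sub>m k)"
    using Suc.IH Bk by (intro upper_triangularI) auto
  ultimately show ?case
    using Suc.prems assms Suc.IH[of i i] upper_triangular_mult_index[of "B ^\<^sub>m k" n B i j]
    by (auto simp del: index_mult_mat simp: mult.commute)
qed (use assms in auto)

lemma sum_diag_mult_commute:
  fixes A B :: "'a :: comm_ring_1 mat"
  assumes "A \<in> carrier_mat n m" "B \<in> carrier_mat m n"
  shows "(\<Sum>i<n. (A * B) $$ (i, i)) = (\<Sum>i<m. (B * A) $$ (i, i))"
proof -
  have "(\<Sum>i<n. (A * B) $$ (i, i)) = (\<Sum>i<n. \<Sum>j<m. A $$ (i, j) * B $$ (j, i))"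
    using assms by (intro sum.cong refl) (auto simp: scalar_prod_def atLeast0LessThan)
  also have "\<dots> = (\<Sum>j<m. \<Sum>i<n. B $$ (j, i) * A $$ (i, j))"
    by (subst sum.swap) (simp add: mult.commute)
  also have "\<dots> = (\<Sum>j<m. (B * A) $$ (j, j))"
    using assms by (intro sum.cong refl) (auto simp: scalar_prod_def atLeast0LessThan)
  finally show ?thesis .
qed

text \<open>
  Schur triangularization: the trace is invariant under similarity, and the diagonal of a power of a
  triangular matrix consists of the powers of its diagonal entries.
\<close>

lemma sum_diag_pow_eq_power_sum:
  fixes A :: "complex mat"
  assumes A: "A \<in> carrier_mat n n" and char: "char_poly A = (\<Prod>a\<leftarrow>as. [:- a, 1:])"
  shows "(\<Sum>i<n. (A ^\<^sub>m k) $$ (i, i)) = (\<Sum>a\<leftarrow>as. a ^ k)"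
proof -
  obtain B P Q where "schur_decomposition A as = (B, P, Q)" by (metis prod_cases3)
  from schur_decomposition[OF A char this]
  have sim: "similar_mat_wit A B P Q" and tri: "upper_triangular B" and diag: "diag_mat B = as" by auto
  note D = similar_mat_witD2[OF A sim]
  have Ak: "A ^\<^sub>m k = P * B ^\<^sub>m k * Q" by (rule similar_mat_wit_pow_id[OF sim])
  have Bk: "B ^\<^sub>m k \<in> carrier_mat n n" using D by simp
  have "(\<Sum>i<n. (A ^\<^sub>m k) $$ (i, i)) = (\<Sum>i<n. (P * (B ^\<^sub>m k * Q)) $$ (i, i))"
    unfolding Ak using D Bk by (simp add: assoc_mult_mat[of _ n n _ n _ n])
  also have "\<dots> = (\<Sum>i<n. (B ^\<^sub>m k * Q * P) $$ (i, i))"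
    using D Bk by (intro sum_diag_mult_commute) auto
  also have "B ^\<^sub>m k * Q * P = B ^\<^sub>m k" using D Bk by (simp add: assoc_mult_mat[of _ n n _ n _ n])
  also have "(\<Sum>i<n. (B ^\<^sub>m k) $$ (i, i)) = (\<Sum>i<n. (B $$ (i, i)) ^ k)"
    using D tri by (intro sum.cong refl) (simp add: upper_triangular_pow_index)
  also have "\<dots> = (\<Sum>a\<leftarrow>as. a ^ k)"
    using D unfolding diag[symmetric] diag_mat_def
    by (simp add: sum_list_sum_nth atLeast0LessThan)
  finally show ?thesis .
qed

lemma det_scaled_one_minus_eq_prod:
  fixes A :: "complex mat"
  assumes A: "A \<in> carrier_mat n n" and char: "char_poly A = (\<Prod>a\<leftarrow>as. [:- a, 1:])"
  shows "det (g \<cdot>\<^sub>m 1\<^sub>m n - u \<cdot>\<^sub>m A) = (\<Prod>a\<leftarrow>as. g - u * a)"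
proof -
  obtain B P Q where "schur_decomposition A as = (B, P, Q)" by (metis prod_cases3)
  from schur_decomposition[OF A char this]
  have sim: "similar_mat_wit A B P Q" and tri: "upper_triangular B" and diag: "diag_mat B = as" by auto
  note D = similar_mat_witD2[OF A sim]
  let ?M = "\<lambda>A. g \<cdot>\<^sub>m 1\<^sub>m n - u \<cdot>\<^sub>m A"
  have M: "?M B \<in> carrier_mat n n" using D(5) by auto
  have "P * ?M B * Q = ?M A"
  proof -
    have "P * ?M B = g \<cdot>\<^sub>m P - u \<cdot>\<^sub>m (P * B)"
      using D by (simp add: mult_minus_distrib_mat[of _ n n _ n] mult_smult_distrib[of _ n n _ n])
    also have "\<dots> * Q = g \<cdot>\<^sub>m (P * Q) - u \<cdot>\<^sub>m (P * B * Q)"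
      using D by (simp add: minus_mult_distrib_mat[of _ n n _ _ n] mult_smult_assoc_mat[of _ n n _ n])
    finally show ?thesis using D by simp
  qed
  hence "det (?M A) = det P * det (?M B) * det Q"
    using D M by (metis det_mult mult_carrier_mat)
  also have "\<dots> = det (?M B) * det (P * Q)" using D(6,7) by (simp add: det_mult[of _ n])
  also have "\<dots> = det (?M B)" using D(1) by simp
  also have "\<dots> = prod_list (diag_mat (?M B))"
    using D(5) upper_triangularD[OF tri] by (intro det_upper_triangular[of _ n] upper_triangularI) auto
  also have "diag_mat (?M B) = map (\<lambda>a. g - u * a) as"
    using D unfolding diag[symmetric] diag_mat_def by auto
  finally show ?thesis .
qed

text \<open>
  Eliminating in two orders in the block matrix with rows \<open>(1, -A)\<close> and \<open>(B, 1)\<close> gives the two sides.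
\<close>

lemma det_one_plus_mult_commute:
  fixes A B :: "'a :: field mat"
  assumes A: "A \<in> carrier_mat n m" and B: "B \<in> carrier_mat m n"
  shows "det (1\<^sub>m n + A * B) = det (1\<^sub>m m + B * A)"
proof -
  let ?M = "four_block_mat (1\<^sub>m n) (- A) B (1\<^sub>m m)"
  let ?U = "four_block_mat (1\<^sub>m n) A (0\<^sub>m m n) (1\<^sub>m m)"
  have M: "?M \<in> carrier_mat (n + m) (n + m)" and U: "?U \<in> carrier_mat (n + m) (n + m)"
    using A B by auto
  have detU: "det ?U = 1"
    using A by (subst det_four_block_mat_lower_left_zero[of _ n _ m]) auto
  have "?M * ?U = four_block_mat (1\<^sub>m n) (0\<^sub>m n m) B (1\<^sub>m m + B * A)"
    using A B by (subst mult_four_block_mat[of _ n n _ m _ m _ _ n _ m])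
      (auto intro!: cong_four_block_mat simp: uminus_l_inv_mat comm_add_mat)
  hence "det ?M * det ?U = det (1\<^sub>m m + B * A)"
    using A B by (subst det_mult[OF M U, symmetric], simp,
      subst det_four_block_mat_upper_right_zero[of _ n _ m]) auto
  moreover have "?U * ?M = four_block_mat (1\<^sub>m n + A * B) (0\<^sub>m n m) B (1\<^sub>m m)"
    using A B by (subst mult_four_block_mat[of _ n n _ m _ m _ _ n _ m])
      (auto intro!: cong_four_block_mat simp: uminus_l_inv_mat)
  hence "det ?U * det ?M = det (1\<^sub>m n + A * B)"
    using A B by (subst det_mult[OF U M, symmetric], simp,
      subst det_four_block_mat_upper_right_zero[of _ n _ m]) auto
  ultimately show ?thesis using detU by simp
qed

lemma det_scaled_one_plus_mult_commute:
  fixes A B :: "'a :: field mat"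
  assumes A: "A \<in> carrier_mat n m" and B: "B \<in> carrier_mat m n" and c: "c \<noteq> 0"
  shows "c ^ m * det (c \<cdot>\<^sub>m 1\<^sub>m n + A * B) = c ^ n * det (c \<cdot>\<^sub>m 1\<^sub>m m + B * A)"
proof -
  have scale: "det (c \<cdot>\<^sub>m 1\<^sub>m n + A * B) = c ^ n * det (1\<^sub>m n + (inverse c \<cdot>\<^sub>m A) * B)"
    if "A \<in> carrier_mat n m" "B \<in> carrier_mat m n" for A B n m
  proof -
    have "c \<cdot>\<^sub>m 1\<^sub>m n + A * B = c \<cdot>\<^sub>m (1\<^sub>m n + (inverse c \<cdot>\<^sub>m A) * B)"
      using that c by (auto intro!: eq_matI simp: mult_smult_assoc_mat[of _ n m _ n] distrib_left)
    thus ?thesis using that by (simp add: det_smult)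
  qed
  have "c ^ m * det (c \<cdot>\<^sub>m 1\<^sub>m n + A * B) = c ^ n * (c ^ m * det (1\<^sub>m m + B * (inverse c \<cdot>\<^sub>m A)))"
    using A B by (simp add: scale[OF A B] det_one_plus_mult_commute[of "inverse c \<cdot>\<^sub>m A" n m])
  also have "B * (inverse c \<cdot>\<^sub>m A) = (inverse c \<cdot>\<^sub>m B) * A"
    using A B by (simp add: mult_smult_assoc_mat[of _ m n _ m] mult_smult_distrib[of _ m n _ m])
  finally show ?thesis by (simp add: scale[OF B A])
qed

section \<open>Matrices indexed by lists\<close>

text \<open>
  Matrices whose rows and columns are labelled by hypervertices, hyperedges or flags. In this form
  matrix products become sums over finite sets, and the enumeration drops out of the calculations.
\<close>

definition kernel_mat :: "'a list \<Rightarrow> 'b list \<Rightarrow> ('a \<Rightarrow> 'b \<Rightarrow> 'c) \<Rightarrow> 'c mat" where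
  "kernel_mat xs ys f = Matrix.mat (length xs) (length ys) (\<lambda>(i, j). f (xs ! i) (ys ! j))"

lemma kernel_mat_carrier [simp]: "kernel_mat xs ys f \<in> carrier_mat (length xs) (length ys)"
  by (simp add: kernel_mat_def)

lemma kernel_mat_index: "i < length xs \<Longrightarrow> j < length ys \<Longrightarrow> kernel_mat xs ys f $$ (i, j) = f (xs ! i) (ys ! j)"
  by (simp add: kernel_mat_def)

lemma kernel_mat_cong:
  assumes "\<And>x y. x \<in> set xs \<Longrightarrow> y \<in> set ys \<Longrightarrow> f x y = g x y"
  shows "kernel_mat xs ys f = kernel_mat xs ys g"
  using assms by (auto simp: kernel_mat_def intro!: eq_matI)

lemma sum_nth_distinct:
  assumes "distinct xs" shows "(\<Sum>i<length xs. f (xs ! i)) = sum f (set xs)"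
  using assms sum_list_distinct_conv_sum_set[of xs f]
  by (simp add: sum_list_sum_nth atLeast0LessThan)

lemma kernel_mat_mult:
  fixes f :: "'a \<Rightarrow> 'b \<Rightarrow> 'k :: comm_ring_1"
  assumes "distinct ys"
  shows "kernel_mat xs ys f * kernel_mat ys zs g
    = kernel_mat xs zs (\<lambda>x z. \<Sum>y\<in>set ys. f x y * g y z)"
  by (rule eq_matI)
    (auto simp: kernel_mat_def scalar_prod_def atLeast0LessThan
      sum_nth_distinct[OF assms, symmetric])

lemma kernel_mat_one: "distinct xs \<Longrightarrow> 1\<^sub>m (length xs) = kernel_mat xs xs (\<lambda>x y. if x = y then 1 else 0)"
  by (rule eq_matI) (auto simp: kernel_mat_def nth_eq_iff_index_eq)

lemma kernel_mat_add: "kernel_mat xs ys f + kernel_mat xs ys g = kernel_mat xs ys (\<lambda>x y. f x y + g x y)"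
  by (rule eq_matI) (auto simp: kernel_mat_def)

lemma kernel_mat_minus: "kernel_mat xs ys f - kernel_mat xs ys g = kernel_mat xs ys (\<lambda>x y. f x y - g x y)"
  by (rule eq_matI) (auto simp: kernel_mat_def)

lemma kernel_mat_smult: "c \<cdot>\<^sub>m kernel_mat xs ys f = kernel_mat xs ys (\<lambda>x y. c * f x y)"
  by (rule eq_matI) (auto simp: kernel_mat_def)

section \<open>Counting closed walks by traces\<close>

lemma cyclic_walk_iff_successively:
  "cyclic_walk R w \<longleftrightarrow> w \<noteq> [] \<and> successively R (last w # w)"
proof (cases "w = []")
  case False
  define l where "l = length w - 1"
  have l: "length w = Suc l" "last w = w ! l" using False by (auto simp: l_def last_conv_nth)
  have "(\<forall>i<length w. R (w ! i) (w ! (Suc i mod length w)))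
    \<longleftrightarrow> (\<forall>i. Suc i < length (last w # w) \<longrightarrow> R ((last w # w) ! i) ((last w # w) ! Suc i))"
    (is "?A \<longleftrightarrow> ?B")
  proof
    assume A: ?A
    show ?B
    proof (intro allI impI)
      fix i assume i: "Suc i < length (last w # w)"
      show "R ((last w # w) ! i) ((last w # w) ! Suc i)"
        using A[rule_format, of "if i = 0 then l else i - 1"] i l by (cases i) auto
    qed
  next
    assume B: ?B
    show ?A
    proof (intro allI impI)
      fix i assume i: "i < length w"
      show "R (w ! i) (w ! (Suc i mod length w))"
        using B[rule_format, of "if i = l then 0 else Suc i"] i l
        by (cases "i = l") auto
    qed
  qed
  thus ?thesis using False by (simp add: cyclic_walk_def successively_conv_nth del: nth_Cons_Suc)
qed (simp add: cyclic_walk_def)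

text \<open>
  The list omits the starting point and contains the end point. A walk from \<open>x\<close> to \<open>x\<close> is
  therefore a cyclic word, in which \<open>x\<close> occurs once as the last letter and not twice.
\<close>

definition walks :: "('a \<Rightarrow> 'a \<Rightarrow> bool) \<Rightarrow> nat \<Rightarrow> 'a \<Rightarrow> 'a \<Rightarrow> 'a list set" where
  "walks R k x y = {w. length w = k \<and> successively R (x # w) \<and> last (x # w) = y}"

lemma walks_0: "walks R 0 x y = (if x = y then {[]} else {})"
  by (auto simp: walks_def)

lemma walks_Suc: "walks R (Suc k) x y = (\<Union>z\<in>{z. R z y}. (\<lambda>w. w @ [y]) ` walks R k x z)"
proof (intro equalityI subsetI)
  fix w assume w: "w \<in> walks R (Suc k) x y"
  then obtain v where v: "w = v @ [y]"
    unfolding walks_def by (cases w rule: rev_cases) auto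
  have "successively R ((x # v) @ [y])" "length v = k" using w v by (auto simp: walks_def)
  hence "v \<in> walks R k x (last (x # v))" "R (last (x # v)) y"
    unfolding successively_append_iff by (auto simp: walks_def)
  thus "w \<in> (\<Union>z\<in>{z. R z y}. (\<lambda>w. w @ [y]) ` walks R k x z)" using v by blast
next
  fix w assume "w \<in> (\<Union>z\<in>{z. R z y}. (\<lambda>w. w @ [y]) ` walks R k x z)"
  then obtain v where v: "v \<in> walks R k x (last (x # v))" "R (last (x # v)) y" "w = v @ [y]"
    by (auto simp: walks_def)
  hence "successively R ((x # v) @ [y])"
    unfolding successively_append_iff by (auto simp: walks_def)
  thus "w \<in> walks R (Suc k) x y" using v by (simp add: walks_def)
qed

lemma finite_walks:
  assumes "finite X" "\<And>x y. R x y \<Longrightarrow> x \<in> X \<and> y \<in> X"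
  shows "finite (walks R k x y)"
proof (induction k arbitrary: y)
  case (Suc k)
  have "finite {z. R z y}" using assms by (blast intro: finite_subset[of _ X])
  thus ?case using Suc by (simp add: walks_Suc)
qed (simp add: walks_0)

lemma card_walks_Suc:
  assumes "finite X" "\<And>x y. R x y \<Longrightarrow> x \<in> X \<and> y \<in> X"
  shows "card (walks R (Suc k) x y) = (\<Sum>z\<in>X. card (walks R k x z) * of_bool (R z y))"
proof -
  have fin: "finite {z. R z y}" using assms by (blast intro: finite_subset[of _ X])
  have "card (walks R (Suc k) x y) = (\<Sum>z\<in>{z. R z y}. card ((\<lambda>w. w @ [y]) ` walks R k x z))"
    unfolding walks_Suc using fin finite_walks[OF assms]
    by (intro card_UN_disjoint) (auto simp: walks_def)
  also have "\<dots> = (\<Sum>z\<in>{z. R z y}. card (walks R k x z))"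
    by (intro sum.cong refl card_image) (simp add: inj_on_def)
  also have "\<dots> = (\<Sum>z\<in>X. card (walks R k x z) * of_bool (R z y))"
    using assms by (intro sum.mono_neutral_cong_left) (auto simp: of_bool_def)
  finally show ?thesis .
qed

lemma transition_mat_pow:
  fixes R :: "'a \<Rightarrow> 'a \<Rightarrow> bool"
  assumes xs: "distinct xs" "\<And>x y. R x y \<Longrightarrow> x \<in> set xs \<and> y \<in> set xs"
  shows "kernel_mat xs xs (\<lambda>x y. of_bool (R x y)) ^\<^sub>m k
    = kernel_mat xs xs (\<lambda>x y. of_nat (card (walks R k x y)) :: 'b :: comm_ring_1)"
proof (induction k)
  case 0
  have "1\<^sub>m (length xs) = kernel_mat xs xs (\<lambda>x y. of_nat (card (walks R 0 x y)) :: 'b)"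
    unfolding kernel_mat_one[OF xs(1)] by (rule kernel_mat_cong) (simp add: walks_0)
  thus ?case by (simp add: kernel_mat_def)
next
  case (Suc k)
  show ?case
    using xs by (auto simp: Suc kernel_mat_mult card_walks_Suc[of "set xs" R] of_nat_sum
      intro!: kernel_mat_cong)
qed

definition cyclic_walks :: "('a \<Rightarrow> 'a \<Rightarrow> bool) \<Rightarrow> nat \<Rightarrow> 'a list set" where
  "cyclic_walks R k = {w. cyclic_walk R w \<and> length w = k}"

lemma cyclic_walks_subset:
  assumes "\<And>x y. R x y \<Longrightarrow> x \<in> X \<and> y \<in> X"
  shows "cyclic_walks R k \<subseteq> {w. set w \<subseteq> X \<and> length w = k}"
proof
  fix w assume w: "w \<in> cyclic_walks R k"
  have "set w \<subseteq> X"
  proof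
    fix x assume "x \<in> set w"
    then obtain i where "i < length w" "x = w ! i" by (auto simp: in_set_conv_nth)
    thus "x \<in> X" using w assms by (auto simp: cyclic_walks_def cyclic_walk_def)
  qed
  thus "w \<in> {w. set w \<subseteq> X \<and> length w = k}" using w by (simp add: cyclic_walks_def)
qed

lemma finite_cyclic_walks:
  assumes "finite X" "\<And>x y. R x y \<Longrightarrow> x \<in> X \<and> y \<in> X"
  shows "finite (cyclic_walks R k)" and "card (cyclic_walks R k) \<le> card X ^ k"
proof -
  note sub = cyclic_walks_subset[of R X k, OF assms(2)]
  show "finite (cyclic_walks R k)"
    using finite_lists_length_eq[OF assms(1), of k] sub by (rule finite_subset[rotated])
  show "card (cyclic_walks R k) \<le> card X ^ k"
    using card_mono[OF finite_lists_length_eq[OF assms(1), of k] sub]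
    by (simp add: card_lists_length_eq[OF assms(1)])
qed

text \<open>
  The trace sums, over the last letter \<open>x\<close>, the closed walks from \<open>x\<close> to \<open>x\<close>.
\<close>

lemma card_cyclic_walks:
  fixes R :: "'a \<Rightarrow> 'a \<Rightarrow> bool"
  assumes xs: "distinct xs" "\<And>x y. R x y \<Longrightarrow> x \<in> set xs \<and> y \<in> set xs" and k: "k > 0"
  shows "of_nat (card (cyclic_walks R k)) = (\<Sum>i<length xs.
    (kernel_mat xs xs (\<lambda>x y. of_bool (R x y)) ^\<^sub>m k) $$ (i, i) :: 'b :: comm_ring_1)"
proof -
  have "cyclic_walks R k = (\<Union>x\<in>set xs. walks R k x x)"
  proof (intro equalityI subsetI)
    fix w assume w: "w \<in> cyclic_walks R k"
    hence "w \<noteq> []" "last w \<in> set xs"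
      using subsetD[OF cyclic_walks_subset[of R "set xs" k, OF xs(2)] w] k last_in_set[of w] by auto
    thus "w \<in> (\<Union>x\<in>set xs. walks R k x x)"
      using w by (auto simp: cyclic_walks_def cyclic_walk_iff_successively walks_def)
  next
    fix w assume "w \<in> (\<Union>x\<in>set xs. walks R k x x)"
    moreover from this have "w \<noteq> []" using k by (auto simp: walks_def)
    ultimately show "w \<in> cyclic_walks R k"
      by (auto simp: cyclic_walks_def cyclic_walk_iff_successively walks_def)
  qed
  also have "card \<dots> = (\<Sum>x\<in>set xs. card (walks R k x x))"
    using finite_walks[of "set xs" R, OF _ xs(2)] k
    by (intro card_UN_disjoint) (auto simp: walks_def)
  also have "of_nat \<dots> = (\<Sum>i<length xs. of_nat (card (walks R k (xs ! i) (xs ! i))) :: 'b)"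
    by (simp add: sum_nth_distinct[OF xs(1), of "\<lambda>x. of_nat (card (walks R k x x)) :: 'b"])
  also have "\<dots> = (\<Sum>i<length xs. (kernel_mat xs xs (\<lambda>x y. of_bool (R x y)) ^\<^sub>m k) $$ (i, i))"
    by (simp add: transition_mat_pow[of xs R, OF xs] kernel_mat_index)
  finally show ?thesis .
qed

section \<open>The logarithmic series over closed walks\<close>

lemma has_sum_minus_Ln:
  assumes "cmod z < 1"
  shows "((\<lambda>n. z ^ n / of_nat n) has_sum - Ln (1 - z)) {1..}"
proof -
  have "(\<lambda>n. z ^ n / of_nat n) sums - Ln (1 - z)"
    using sums_minus[OF Ln_series'[of "- z"]] assms by simp
  moreover have "summable (\<lambda>n. norm (z ^ n / of_nat n))"
  proof (rule summable_comparison_test')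
    show "summable (\<lambda>n. cmod z ^ n)" using assms by (simp add: summable_geometric)
    show "norm (norm (z ^ n / of_nat n)) \<le> cmod z ^ n" for n
      by (cases "n = 0") (auto simp: norm_divide norm_power divide_le_eq mult_le_cancel_left1 zero_le_power)
  qed
  ultimately have "((\<lambda>n. z ^ n / of_nat n) has_sum - Ln (1 - z)) UNIV"
    by (intro norm_summable_imp_has_sum)
  thus ?thesis by (subst has_sum_cong_neutral[where T = UNIV]) auto
qed

text \<open>
  Grouped by length, the sum is \<open>\<Sum>k. tr (T\<^sup>k) u\<^sup>k / k\<close>; with the eigenvalues \<open>a\<close> of \<open>T\<close> in \<open>as\<close>, it
  splits into the logarithmic series of the numbers \<open>1 - u a\<close>. The bound on \<open>u\<close> in terms of the
  number of letters gives absolute convergence, which justifies the regrouping.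
\<close>

lemma cyclic_walks_has_sum:
  fixes R :: "'a \<Rightarrow> 'a \<Rightarrow> bool" and as :: "complex list"
  assumes xs: "distinct xs" "\<And>x y. R x y \<Longrightarrow> x \<in> set xs \<and> y \<in> set xs"
    and char: "char_poly (kernel_mat xs xs (\<lambda>x y. of_bool (R x y))) = (\<Prod>a\<leftarrow>as. [:- a, 1:])"
    and u: "cmod u * real (length xs) < 1" "\<And>a. a \<in> set as \<Longrightarrow> cmod (u * a) < 1"
  shows "((\<lambda>w. u ^ length w / of_nat (length w)) has_sum (\<Sum>a\<leftarrow>as. - Ln (1 - u * a))) {w. cyclic_walk R w}"
proof -
  let ?f = "\<lambda>w :: 'a list. u ^ length w / of_nat (length w)"
  let ?S = "Sigma {1..} (cyclic_walks R)"
  let ?g = "\<lambda>k. of_nat (card (cyclic_walks R k)) * (u ^ k / of_nat k)"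
  note fin = finite_cyclic_walks[of "set xs" R, OF _ xs(2)]
  have bij: "bij_betw snd ?S {w. cyclic_walk R w}"
    by (rule bij_betwI[of _ _ _ "\<lambda>w. (length w, w)"])
      (auto simp: cyclic_walks_def cyclic_walk_def Suc_le_eq)
  have inner: "((\<lambda>w. ?f w) has_sum ?g k) (cyclic_walks R k)" for k
    by (rule has_sum_finiteI) (use fin in \<open>auto simp: cyclic_walks_def\<close>)
  have "(\<lambda>p. norm (?f (snd p))) summable_on ?S"
    unfolding Infinite_Sum.abs_summable_on_Sigma_iff
  proof (intro conjI ballI)
    fix k show "(\<lambda>w. norm (?f (snd (k, w)))) summable_on cyclic_walks R k"
      using fin by simp
  next
    let ?c = "cmod u * real (length xs)"
    have "summable (\<lambda>n. norm (?c ^ n))" using u by (simp add: norm_power summable_geometric)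
    hence "(\<lambda>n. ?c ^ n) summable_on {1..}"
      using norm_summable_imp_summable_on summable_on_subset_banach by blast
    thus "(\<lambda>k. norm (\<Sum>\<^sub>\<infinity>w\<in>cyclic_walks R k. norm (?f (snd (k, w))))) summable_on {1..}"
    proof (rule Infinite_Sum.abs_summable_on_comparison_test')
      fix k :: nat assume k: "k \<in> {1..}"
      have "(\<Sum>\<^sub>\<infinity>w\<in>cyclic_walks R k. norm (?f (snd (k, w)))) = (\<Sum>w\<in>cyclic_walks R k. norm (?f w))"
        using fin by simp
      also have "\<dots> = real (card (cyclic_walks R k)) * (cmod u ^ k / real k)"
        by (simp add: cyclic_walks_def norm_divide norm_power)
      also have "\<dots> \<le> real (length xs ^ k) * (cmod u ^ k / 1)"
        using fin(2)[of k] k distinct_card[OF xs(1)]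
        by (intro mult_mono divide_left_mono) (auto simp flip: of_nat_power)
      also have "\<dots> = ?c ^ k" by (simp add: power_mult_distrib)
      finally show "norm (\<Sum>\<^sub>\<infinity>w\<in>cyclic_walks R k. norm (?f (snd (k, w)))) \<le> ?c ^ k"
        by (simp add: infsum_nonneg)
    qed
  qed
  then obtain S where S: "((\<lambda>p. ?f (snd p)) has_sum S) ?S"
    using abs_summable_summable[of "\<lambda>p. ?f (snd p)" ?S] unfolding summable_on_def by blast
  have "(?g has_sum S) {1..}"
    using S by (rule has_sum_SigmaD) (use inner in simp)
  moreover have "(?g has_sum (\<Sum>a\<leftarrow>as. - Ln (1 - u * a))) {1..}"
  proof -
    have "((\<lambda>k. \<Sum>a\<leftarrow>as. (u * a) ^ k / of_nat k) has_sum (\<Sum>a\<leftarrow>as. - Ln (1 - u * a))) {1..}"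
      using u(2)
    proof (induction as)
      case (Cons a as)
      have "((\<lambda>k. (u * a) ^ k / of_nat k + (\<Sum>a\<leftarrow>as. (u * a) ^ k / of_nat k)) has_sum
          (- Ln (1 - u * a) + (\<Sum>a\<leftarrow>as. - Ln (1 - u * a)))) {1..}"
        by (intro has_sum_add has_sum_minus_Ln Cons) (use Cons.prems in auto)
      thus ?case by simp
    qed simp
    moreover have "(\<Sum>a\<leftarrow>as. (u * a) ^ k / of_nat k) = ?g k" if "k \<in> {1..}" for k
    proof -
      have "of_nat (card (cyclic_walks R k)) = (\<Sum>a\<leftarrow>as. a ^ k)"
        using that card_cyclic_walks[of xs R k, OF xs, where 'b = complex]
          sum_diag_pow_eq_power_sum[OF kernel_mat_carrier char, of k] by simp
      moreover have "(\<Sum>a\<leftarrow>as. (u * a) ^ k / of_nat k) = (\<Sum>a\<leftarrow>as. a ^ k * (u ^ k / of_nat k))"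
        by (simp add: power_mult_distrib mult.commute)
      ultimately show ?thesis by (simp only: sum_list_mult_const)
    qed
    ultimately show ?thesis by (subst (asm) has_sum_cong)
  qed
  ultimately have "S = (\<Sum>a\<leftarrow>as. - Ln (1 - u * a))" by (rule has_sum_unique)
  thus ?thesis using S has_sum_reindex_bij_betw[OF bij, of ?f] by simp
qed

section \<open>Prime cycles and the Euler product\<close>

definition flags :: "('v, 'e) hypergraph \<Rightarrow> ('v \<times> 'e) set" where
  "flags H = {(v, e). e \<in> hedges H \<and> v \<in> ends H e}"

text \<open>
  One step of a closed path: from \<open>(v, e)\<close> the path moves within \<open>e\<close> to another hypervertex and leaves
  it through another hyperedge.
\<close>

definition flag_step :: "('v, 'e) hypergraph \<Rightarrow> 'v \<times> 'e \<Rightarrow> 'v \<times> 'e \<Rightarrow> bool" where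
  "flag_step H x y \<longleftrightarrow> x \<in> flags H \<and> y \<in> flags H \<and>
     fst y \<in> ends H (snd x) \<and> fst x \<noteq> fst y \<and> snd x \<noteq> snd y"

lemma flag_step_flags: "flag_step H x y \<Longrightarrow> x \<in> flags H \<and> y \<in> flags H"
  by (simp add: flag_step_def)

lemma finite_flags:
  assumes "finite_hypergraph H" shows "finite (flags H)"
proof (rule finite_subset)
  show "flags H \<subseteq> hverts H \<times> hedges H"
    using assms by (auto simp: finite_hypergraph_def is_hypergraph_def flags_def)
  show "finite (hverts H \<times> hedges H)" using assms by (simp add: finite_hypergraph_def)
qed

text \<open>
  In \<open>c\<^sup>2\<close> the last hyperedge of \<open>c\<close> is followed by the first one, so absence of backtracking in \<open>c\<^sup>2\<close>
  is the cyclic condition, including the wrap-around.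
\<close>

lemma closed_path_tailless_iff:
  assumes H: "is_hypergraph H"
  shows "closed_path H c \<and> tailless c \<longleftrightarrow> cyclic_walk (flag_step H) c"
proof (cases "c = []")
  case False
  let ?l = "length c"
  have cp: "closed_path H c \<longleftrightarrow> (\<forall>i<?l. c ! i \<in> flags H \<and>
      fst (c ! (Suc i mod ?l)) \<in> ends H (snd (c ! i)) \<and> fst (c ! i) \<noteq> fst (c ! (Suc i mod ?l)))"
    using False H by (auto simp: closed_path_def flags_def is_hypergraph_def Let_def case_prod_unfold)
  have tl: "tailless c \<longleftrightarrow> (\<forall>i<?l. snd (c ! i) \<noteq> snd (c ! (Suc i mod ?l)))"
  proof
    assume T: "tailless c"
    show "\<forall>i<?l. snd (c ! i) \<noteq> snd (c ! (Suc i mod ?l))"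
    proof (intro allI impI)
      fix i assume i: "i < ?l"
      hence "Suc i < 2 * ?l" by linarith
      hence "snd (path_power c 2 ! i) \<noteq> snd (path_power c 2 ! Suc i)"
        using T by (simp add: tailless_def hyperedge_backtracking_def)
      thus "snd (c ! i) \<noteq> snd (c ! (Suc i mod ?l))"
        using \<open>Suc i < 2 * ?l\<close> i nth_path_power[of i 2 c] nth_path_power[of "Suc i" 2 c] by simp
    qed
  next
    assume A: "\<forall>i<?l. snd (c ! i) \<noteq> snd (c ! (Suc i mod ?l))"
    show "tailless c"
      unfolding tailless_def hyperedge_backtracking_def
    proof (intro notI, elim exE conjE)
      fix i assume i: "Suc i < length (path_power c 2)"
        and "snd (path_power c 2 ! i) = snd (path_power c 2 ! Suc i)"
      hence "snd (c ! (i mod ?l)) = snd (c ! (Suc i mod ?l))"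
        using nth_path_power[of i 2 c] nth_path_power[of "Suc i" 2 c] by simp
      with A[rule_format, of "i mod ?l"] False show False by (simp add: mod_Suc_eq)
    qed
  qed
  have next_flag: "c ! (Suc i mod ?l) \<in> flags H" if "\<forall>i<?l. c ! i \<in> flags H" for i
    using that False by simp
  show ?thesis
    unfolding cp tl cyclic_walk_def flag_step_def using False next_flag by blast
qed (simp add: closed_path_def cyclic_walk_def)

lemma primitive_cycle_iff:
  assumes H: "is_hypergraph H"
  shows "primitive_cycle H c \<longleftrightarrow> cyclic_walk (flag_step H) c \<and> primitive_word c"
proof
  assume P: "primitive_cycle H c"
  hence walk: "cyclic_walk (flag_step H) c"
    using closed_path_tailless_iff[OF H] by (auto simp: primitive_cycle_def)
  have "primitive_word c"
    unfolding primitive_word_def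
  proof (rule conjI, use walk in \<open>simp add: cyclic_walk_def\<close>, rule notI)
    assume "\<exists>b m. 2 \<le> m \<and> c = path_power b m"
    then obtain b m where bm: "2 \<le> m" "c = path_power b m" by blast
    hence "cyclic_walk (flag_step H) b" using walk cyclic_walk_path_power[of m "flag_step H" b] by simp
    hence "closed_path H b" using closed_path_tailless_iff[OF H] by blast
    with bm P show False by (auto simp: primitive_cycle_def)
  qed
  with walk show "cyclic_walk (flag_step H) c \<and> primitive_word c" ..
next
  assume W: "cyclic_walk (flag_step H) c \<and> primitive_word c"
  hence cp: "closed_path H c" and tl: "tailless c" using closed_path_tailless_iff[OF H] by auto
  have "\<not> hyperedge_backtracking c"
  proof
    assume "hyperedge_backtracking c"
    then obtain i where "Suc i < length c" "snd (c ! i) = snd (c ! Suc i)"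
      by (auto simp: hyperedge_backtracking_def)
    hence "hyperedge_backtracking (path_power c 2)"
      using nth_path_power[of i 2 c] nth_path_power[of "Suc i" 2 c]
      by (auto simp: hyperedge_backtracking_def intro!: exI[of _ i])
    with tl show False by (simp add: tailless_def)
  qed
  with cp tl W show "primitive_cycle H c" by (auto simp: primitive_cycle_def primitive_word_def)
qed

lemma equiv_rotation:
  assumes H: "is_hypergraph H"
  shows "equiv {c. primitive_cycle H c}
    {(b, c). primitive_cycle H b \<and> primitive_cycle H c \<and> (\<exists>n. c = rotate n b)}"
proof (rule equivI)
  show "refl_on {c. primitive_cycle H c} {(b, c). primitive_cycle H b \<and> primitive_cycle H c \<and> (\<exists>n. c = rotate n b)}"
    by (auto intro!: refl_onI exI[of _ 0])
  show "sym {(b, c). primitive_cycle H b \<and> primitive_cycle H c \<and> (\<exists>n. c = rotate n b)}"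
  proof (rule symI, clarsimp)
    fix b :: "('a \<times> 'b) list" and n assume "primitive_cycle H b"
    hence "b \<noteq> []" by (simp add: primitive_cycle_def closed_path_def)
    hence "n \<le> n * length b" by (cases b) auto
    hence "rotate (n * length b - n) (rotate n b) = b" by (simp add: rotate_rotate)
    thus "\<exists>na. b = rotate na (rotate n b)" by metis
  qed
  show "trans {(b, c). primitive_cycle H b \<and> primitive_cycle H c \<and> (\<exists>n. c = rotate n b)}"
    by (rule transI) (auto simp: rotate_rotate)
qed auto

lemma prime_cycle_eq_rotations:
  assumes H: "is_hypergraph H" and p: "p \<in> prime_cycles H"
  obtains c where "primitive_cycle H c" "p = (\<lambda>n. rotate n c) ` {..<length c}"
proof -
  from p obtain c where c: "primitive_cycle H c"
    and p_eq: "p = {(b, c). primitive_cycle H b \<and> primitive_cycle H c \<and> (\<exists>n. c = rotate n b)} `` {c}"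
    unfolding prime_cycles_def by (auto elim: quotientE)
  have "primitive_cycle H (rotate n c)" for n
    using c primitive_word_rotate cyclic_walk_rotate unfolding primitive_cycle_iff[OF H] by blast
  hence "p = range (\<lambda>n. rotate n c)" using c p_eq by auto
  also have "\<dots> = (\<lambda>n. rotate n c) ` {..<length c}"
  proof -
    have "rotate n c \<in> (\<lambda>n. rotate n c) ` {..<length c}" for n
      using c rotate_conv_mod[of n c] by (auto simp: primitive_cycle_def closed_path_def)
    thus ?thesis by blast
  qed
  finally show ?thesis using that c by blast
qed

lemma prime_cycle_card:
  assumes H: "is_hypergraph H" and p: "p \<in> prime_cycles H"
  shows "finite p" "card p = cycle_length p" "cycle_length p > 0"
    and "\<And>c. c \<in> p \<Longrightarrow> length c = cycle_length p"
proof -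
  obtain c where c: "primitive_cycle H c" and p_eq: "p = (\<lambda>n. rotate n c) ` {..<length c}"
    using prime_cycle_eq_rotations[OF H p] by blast
  have ne: "c \<noteq> []" using c by (simp add: primitive_cycle_def closed_path_def)
  have len: "length b = length c" if "b \<in> p" for b using that p_eq by auto
  have "c \<in> p" using ne unfolding p_eq by (intro image_eqI[of _ _ 0]) auto
  hence cl: "cycle_length p = length c"
    unfolding cycle_length_def by (intro len someI)
  show "finite p" using p_eq by simp
  have "card p = length c"
    using c inj_on_rotate_primitive[of c] unfolding primitive_cycle_iff[OF H] p_eq
    by (simp add: card_image)
  thus "card p = cycle_length p" using cl by simp
  show "cycle_length p > 0" using ne cl by simp
  show "length b = cycle_length p" if "b \<in> p" for b using len[OF that] cl by simp
qed

lemma bij_betw_prime_cycles: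
  assumes H: "is_hypergraph H"
  shows "bij_betw snd (Sigma (prime_cycles H) (\<lambda>p. p)) {c. primitive_cycle H c}"
proof -
  note eq = equiv_rotation[OF H]
  have "inj_on snd (Sigma (prime_cycles H) (\<lambda>p. p))"
    using quotient_disj[OF eq] unfolding prime_cycles_def by (force simp: inj_on_def)
  moreover have "snd ` Sigma (prime_cycles H) (\<lambda>p. p) = \<Union> (prime_cycles H)" by force
  ultimately show ?thesis
    using Union_quotient[OF eq] by (simp add: bij_betw_def prime_cycles_def)
qed

text \<open>
  This turns the sum over closed walks into a sum over primitive cycles and exponents.
\<close>

lemma bij_betw_path_power:
  assumes H: "is_hypergraph H"
  shows "bij_betw (\<lambda>(c, m). path_power c m) ({c. primitive_cycle H c} \<times> {1..})
    {w. cyclic_walk (flag_step H) w}"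
  unfolding bij_betw_def
proof (intro conjI equalityI subsetI)
  show "inj_on (\<lambda>(c, m). path_power c m) ({c. primitive_cycle H c} \<times> {1..})"
  proof (rule inj_onI, clarsimp simp del: One_nat_def)
    fix b c :: "('a \<times> 'b) list" and m n :: nat
    assume "primitive_cycle H b" "primitive_cycle H c" "1 \<le> m" "1 \<le> n" "path_power b m = path_power c n"
    thus "b = c \<and> m = n"
      using primitive_root_unique[of b c m n] by (simp add: primitive_cycle_iff[OF H] Suc_le_eq)
  qed
  fix w assume "w \<in> (\<lambda>(c, m). path_power c m) ` ({c. primitive_cycle H c} \<times> {1..})"
  thus "w \<in> {w. cyclic_walk (flag_step H) w}"
    unfolding primitive_cycle_iff[OF H] by (auto simp: cyclic_walk_path_power Suc_le_eq)
next
  fix w assume w: "w \<in> {w. cyclic_walk (flag_step H) w}"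
  hence "w \<noteq> []" by (simp add: cyclic_walk_def)
  then obtain c m where cm: "primitive_word c" "m > 0" "w = path_power c m"
    by (rule primitive_root_exists)
  hence "primitive_cycle H c" using w by (simp add: primitive_cycle_iff[OF H] cyclic_walk_path_power)
  with cm show "w \<in> (\<lambda>(c, m). path_power c m) ` ({c. primitive_cycle H c} \<times> {1..})"
    by (intro image_eqI[of _ _ "(c, m)"]) (auto simp: Suc_le_eq)
qed

text \<open>
  A closed walk \<open>c\<^sup>m\<close> contributes \<open>u\<^bsup>m|c|\<^esup> / (m |c|)\<close>. Summing over \<open>m\<close> gives a logarithm divided by \<open>|c|\<close>,
  and the \<open>|c|\<close> rotations of \<open>c\<close> together cancel this denominator.
\<close>

lemma prime_cycles_has_sum:
  assumes H: "is_hypergraph H" and u: "cmod u < 1"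
    and S: "((\<lambda>w. u ^ length w / of_nat (length w)) has_sum S) {w. cyclic_walk (flag_step H) w}"
  shows "((\<lambda>p. - Ln (1 - u ^ cycle_length p)) has_sum S) (prime_cycles H)"
proof -
  have ul: "cmod (u ^ n) < 1" if "n > 0" for n
    using u that by (simp add: norm_power power_less_one_iff)
  let ?L = "\<lambda>n. - Ln (1 - u ^ n)"
  have "((\<lambda>(c, m). u ^ (m * length c) / of_nat (m * length c)) has_sum S)
      ({c. primitive_cycle H c} \<times> {1..})"
    using S has_sum_reindex_bij_betw[OF bij_betw_path_power[OF H],
        of "\<lambda>w. u ^ length w / of_nat (length w)"] by (simp add: case_prod_unfold)
  hence "((\<lambda>c. ?L (length c) / of_nat (length c)) has_sum S) {c. primitive_cycle H c}"
  proof (rule has_sum_SigmaD)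
    fix c assume "c \<in> {c. primitive_cycle H c}"
    hence "length c > 0" by (simp add: primitive_cycle_def closed_path_def)
    from has_sum_divide_const[OF has_sum_minus_Ln[OF ul[OF this]], of "of_nat (length c)"]
    show "((\<lambda>m. case (c, m) of (c, m) \<Rightarrow> u ^ (m * length c) / of_nat (m * length c)) has_sum
        ?L (length c) / of_nat (length c)) {1..}"
      by (simp add: power_mult[symmetric] mult.commute)
  qed
  hence "((\<lambda>(p, c). ?L (length c) / of_nat (length c)) has_sum S) (Sigma (prime_cycles H) (\<lambda>p. p))"
    using has_sum_reindex_bij_betw[OF bij_betw_prime_cycles[OF H],
        of "\<lambda>c. ?L (length c) / of_nat (length c)"] by (simp add: case_prod_unfold)
  thus ?thesis
  proof (rule has_sum_SigmaD)
    fix p assume p: "p \<in> prime_cycles H"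
    note P = prime_cycle_card[OF H p]
    have "(\<Sum>c\<in>p. ?L (length c) / of_nat (length c)) =
        (\<Sum>c\<in>p. ?L (cycle_length p) / of_nat (cycle_length p))"
      by (intro sum.cong refl) (simp add: P(4))
    also have "\<dots> = ?L (cycle_length p)" using P(2,3) by simp
    finally show "((\<lambda>c. case (p, c) of (p, c) \<Rightarrow> ?L (length c) / of_nat (length c)) has_sum
        ?L (cycle_length p)) p"
      using P(1) by (intro has_sum_finiteI) simp_all
  qed
qed

text \<open>
  The exponential of the sum over closed walks is the Euler product on the one hand and the product of
  the inverses of \<open>1 - u a\<close> over the eigenvalues \<open>a\<close> of \<open>T\<close> on the other.
\<close>

theorem euler_product_eq_inverse_det:
  fixes H :: "('v, 'e) hypergraph"
  assumes fin: "finite_hypergraph H" and xs: "distinct xs" "set xs = flags H"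
  defines "T \<equiv> kernel_mat xs xs (\<lambda>x y. of_bool (flag_step H x y)) :: complex mat"
  shows "\<exists>\<epsilon>>0. \<forall>u. cmod u < \<epsilon> \<longrightarrow>
    euler_product H u (inverse (det (1\<^sub>m (length xs) - u \<cdot>\<^sub>m T)))"
proof -
  have H: "is_hypergraph H" using fin by (simp add: finite_hypergraph_def)
  have T: "T \<in> carrier_mat (length xs) (length xs)" by (simp add: T_def)
  obtain as where char: "char_poly T = (\<Prod>a\<leftarrow>as. [:- a, 1:])"
    using char_poly_factorized[OF T] by blast
  \<comment> \<open>For \<open>|u| < 1/M\<close> all three smallness conditions hold: on \<open>u\<close>, on
    \<open>u\<close> times the number of flags and on \<open>u\<close> times each eigenvalue.\<close>
  define M where "M = 1 + real (length xs) + (\<Sum>a\<leftarrow>as. cmod a)"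
  have M: "M > 0" "M \<ge> 1" "M \<ge> real (length xs)"
  proof -
    have "0 \<le> (\<Sum>a\<leftarrow>as. cmod a)" by (rule sum_list_nonneg) auto
    thus "M > 0" "M \<ge> 1" "M \<ge> real (length xs)" by (auto simp: M_def)
  qed
  have Ma: "cmod a < M" if "a \<in> set as" for a
  proof -
    have "cmod a \<le> (\<Sum>a\<leftarrow>as. cmod a)" using that by (intro member_le_sum_list) auto
    thus ?thesis by (simp add: M_def)
  qed
  have "euler_product H u (inverse (det (1\<^sub>m (length xs) - u \<cdot>\<^sub>m T)))"
    if u: "cmod u < inverse M" for u
  proof -
    have uM: "cmod u * M < 1" using u M(1) by (simp add: field_simps)
    have small: "cmod u * x < 1" if "x \<le> M" for x
      using mult_left_mono[OF that, of "cmod u"] uM by simp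
    have ua: "cmod (u * a) < 1" if "a \<in> set as" for a
      using small[of "cmod a"] Ma[OF that] by (simp add: norm_mult)
    define S where "S = (\<Sum>a\<leftarrow>as. - Ln (1 - u * a))"
    have "((\<lambda>w. u ^ length w / of_nat (length w)) has_sum S) {w. cyclic_walk (flag_step H) w}"
      unfolding S_def using flag_step_flags[of H] small[OF M(3)] ua char xs
      by (intro cyclic_walks_has_sum[of xs]) (auto simp: T_def)
    hence "((\<lambda>p. - Ln (1 - u ^ cycle_length p)) has_sum S) (prime_cycles H)"
      using small[of 1] M by (intro prime_cycles_has_sum[OF H]) auto
    hence "((\<lambda>P. exp (\<Sum>p\<in>P. - Ln (1 - u ^ cycle_length p))) \<longlongrightarrow> exp S)
        (finite_subsets_at_top (prime_cycles H))"
      unfolding has_sum_def by (rule tendsto_exp)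
    moreover have "exp (\<Sum>p\<in>P. - Ln (1 - u ^ cycle_length p)) = (\<Prod>p\<in>P. inverse (1 - u ^ cycle_length p))"
      if P: "finite P" "P \<subseteq> prime_cycles H" for P
    proof -
      have "1 - u ^ cycle_length p \<noteq> 0" if "p \<in> P" for p
      proof
        assume "1 - u ^ cycle_length p = 0"
        hence "cmod (u ^ cycle_length p) = 1" by simp
        moreover have "cycle_length p > 0" using prime_cycle_card(3)[OF H] that P by blast
        moreover from this have "cmod u ^ cycle_length p < 1"
          using small[of 1] M by (simp add: power_less_one_iff)
        ultimately show False by (simp add: norm_power)
      qed
      thus ?thesis using P(1) by (simp add: exp_sum exp_minus)
    qed
    hence "\<forall>\<^sub>F P in finite_subsets_at_top (prime_cycles H).
        exp (\<Sum>p\<in>P. - Ln (1 - u ^ cycle_length p)) = (\<Prod>p\<in>P. inverse (1 - u ^ cycle_length p))"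
      by (intro eventually_finite_subsets_at_top_weakI)
    ultimately have "euler_product H u (exp S)"
      unfolding euler_product_def by (rule Lim_transform_eventually)
    moreover have "exp S = inverse (\<Prod>a\<leftarrow>as. 1 - u * a)"
    proof -
      have "1 - u * a \<noteq> 0" if "a \<in> set as" for a using ua[OF that] by auto
      thus ?thesis unfolding S_def
        by (induction as) (auto simp: exp_add exp_minus exp_diff field_simps)
    qed
    moreover have "det (1\<^sub>m (length xs) - u \<cdot>\<^sub>m T) = (\<Prod>a\<leftarrow>as. 1 - u * a)"
    proof -
      have "1 \<cdot>\<^sub>m 1\<^sub>m (length xs) = (1\<^sub>m (length xs) :: complex mat)" by (rule eq_matI) auto
      thus ?thesis using det_scaled_one_minus_eq_prod[OF T char, of 1 u] by simp
    qed
    ultimately show ?thesis by simp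
  qed
  thus ?thesis using M(1) by (intro exI[of _ "inverse M"]) simp
qed

section \<open>The determinant of the flag transition matrix\<close>

lemma sum_of_bool_mult_left:
  fixes f :: "'a \<Rightarrow> 'b :: comm_ring_1"
  assumes "finite A" "a \<in> A"
  shows "(\<Sum>y\<in>A. of_bool (a = y) * f y) = f a" "(\<Sum>y\<in>A. of_bool (y = a) * f y) = f a"
proof -
  have "(\<Sum>y\<in>A. of_bool (a = y) * f y) = (\<Sum>y\<in>A. if a = y then f y else 0)"
    by (intro sum.cong refl) auto
  thus 1: "(\<Sum>y\<in>A. of_bool (a = y) * f y) = f a" using assms by simp
  have "(\<Sum>y\<in>A. of_bool (y = a) * f y) = (\<Sum>y\<in>A. of_bool (a = y) * f y)"
    by (intro sum.cong refl) auto
  thus "(\<Sum>y\<in>A. of_bool (y = a) * f y) = f a" using 1 by simp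
qed

lemma sum_of_bool_card:
  "finite A \<Longrightarrow> (\<Sum>y\<in>A. of_bool (P y) :: 'b :: comm_ring_1) = of_nat (card {y \<in> A. P y})"
  by (simp add: of_bool_def sum.If_cases Int_def conj_commute)

lemma kernel_mat_scalar:
  "distinct xs \<Longrightarrow> (c :: 'b :: comm_ring_1) \<cdot>\<^sub>m 1\<^sub>m (length xs) = kernel_mat xs xs (\<lambda>x y. c * of_bool (x = y))"
  by (auto simp: kernel_mat_one kernel_mat_smult intro!: kernel_mat_cong)

lemma vert_list:
  assumes "finite_hypergraph H"
  shows "distinct (vert_list H)" "set (vert_list H) = hverts H" "length (vert_list H) = card (hverts H)"
proof -
  have "\<exists>vs. distinct vs \<and> set vs = hverts H"
    using assms finite_distinct_list[of "hverts H"] by (auto simp: finite_hypergraph_def)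
  from someI_ex[OF this] show *: "distinct (vert_list H)" "set (vert_list H) = hverts H"
    by (auto simp: vert_list_def)
  show "length (vert_list H) = card (hverts H)" using distinct_card[OF *(1)] *(2) by simp
qed

lemma adj_matrix_eq_kernel_mat:
  assumes "finite_hypergraph H"
  shows "adj_matrix H = kernel_mat (vert_list H) (vert_list H) (\<lambda>v w. of_nat (adj_entry H v w))"
  by (simp add: adj_matrix_def kernel_mat_def vert_list[OF assms])

lemma card_flags_edge:
  assumes "regular_hypergraph d r H" "e \<in> hedges H"
  shows "card {y \<in> flags H. snd y = e} = r"
proof -
  have "{y \<in> flags H. snd y = e} = (\<lambda>v. (v, e)) ` ends H e" using assms(2) by (auto simp: flags_def)
  thus ?thesis using assms by (simp add: card_image inj_on_def regular_hypergraph_def)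
qed

lemma card_flags_vert_pair:
  assumes "regular_hypergraph d r H" "v \<in> hverts H"
  shows "card {y \<in> flags H. fst y = v \<and> w \<in> ends H (snd y)} = adj_entry H v w + (if v = w then d else 0)"
proof -
  have "{y \<in> flags H. fst y = v \<and> w \<in> ends H (snd y)}
      = (\<lambda>e. (v, e)) ` {e \<in> hedges H. v \<in> ends H e \<and> w \<in> ends H e}" by (auto simp: flags_def)
  hence "card {y \<in> flags H. fst y = v \<and> w \<in> ends H (snd y)}
      = card {e \<in> hedges H. v \<in> ends H e \<and> w \<in> ends H e}" by (simp add: card_image inj_on_def)
  thus ?thesis using assms by (auto simp: adj_entry_eq regular_hypergraph_def)
qed

lemma card_flags_vert:
  assumes "regular_hypergraph d r H" "v \<in> hverts H"
  shows "card {y \<in> flags H. fst y = v} = d"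
proof -
  have "{y \<in> flags H. fst y = v} = {y \<in> flags H. fst y = v \<and> v \<in> ends H (snd y)}"
    by (auto simp: flags_def)
  thus ?thesis using card_flags_vert_pair[OF assms, of v] by (simp add: adj_entry_eq)
qed

lemma card_flags:
  assumes fin: "finite_hypergraph H" and reg: "regular_hypergraph d r H"
  shows "card (flags H) = card (hverts H) * d" "card (flags H) = card (hedges H) * r"
proof -
  have H: "fst y \<in> hverts H" "snd y \<in> hedges H" if "y \<in> flags H" for y
    using that fin by (auto simp: flags_def finite_hypergraph_def is_hypergraph_def)
  have f: "finite (hverts H)" "finite (hedges H)" "finite (flags H)"
    using fin finite_flags by (auto simp: finite_hypergraph_def)
  have "flags H = (\<Union>v\<in>hverts H. {y \<in> flags H. fst y = v})" using H by auto
  also have "card \<dots> = (\<Sum>v\<in>hverts H. card {y \<in> flags H. fst y = v})"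
    using f by (intro card_UN_disjoint) auto
  finally show "card (flags H) = card (hverts H) * d"
    using card_flags_vert[OF reg] by simp
  have "flags H = (\<Union>e\<in>hedges H. {y \<in> flags H. snd y = e})" using H by auto
  also have "card \<dots> = (\<Sum>e\<in>hedges H. card {y \<in> flags H. snd y = e})"
    using f by (intro card_UN_disjoint) auto
  finally show "card (flags H) = card (hedges H) * r"
    using card_flags_edge[OF reg] by simp
qed

text \<open>
  The matrix is \<open>(1 - u) + u P\<close>, where \<open>P\<close> is the 0-1 matrix of "same hyperedge". As \<open>P\<close> factors
  through the functions on hyperedges, where the reversed product is the scalar \<open>r\<close>, the
  determinant is that of a scalar matrix of size \<open>n\<^sub>2\<close>.
\<close>

lemma det_same_edge_kernel:
  fixes u :: complex
  assumes fin: "finite_hypergraph H" and reg: "regular_hypergraph d r H"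
    and xs: "distinct xs" "set xs = flags H" and u: "u \<noteq> 1"
  shows "(1 - u) ^ card (hedges H) * det
      (kernel_mat xs xs (\<lambda>x y. (1 - u) * of_bool (x = y) + u * of_bool (snd x = snd y)))
    = (1 - u) ^ length xs * (1 + (of_nat r - 1) * u) ^ card (hedges H)"
proof -
  have f: "finite (hedges H)" "finite (flags H)"
    using fin finite_flags by (auto simp: finite_hypergraph_def)
  obtain es where es: "distinct es" "set es = hedges H"
    using finite_distinct_list[OF f(1)] by blast
  have len: "length es = card (hedges H)" using distinct_card[OF es(1)] es(2) by simp
  let ?B = "kernel_mat xs es (\<lambda>x e. u * of_bool (snd x = e))"
  let ?B' = "kernel_mat es xs (\<lambda>e x. of_bool (e = snd x))"
  have BB': "(1 - u) \<cdot>\<^sub>m 1\<^sub>m (length xs) + ?B * ?B'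
      = kernel_mat xs xs (\<lambda>x y. (1 - u) * of_bool (x = y) + u * of_bool (snd x = snd y))"
    unfolding kernel_mat_scalar[OF xs(1)] kernel_mat_mult[OF es(1)] kernel_mat_add
  proof (rule kernel_mat_cong)
    fix x y assume "x \<in> set xs" "y \<in> set xs"
    hence "snd x \<in> hedges H" using xs by (auto simp: flags_def)
    hence "(\<Sum>e\<in>hedges H. of_bool (snd x = e) * (u * of_bool (e = snd y))) = u * of_bool (snd x = snd y)"
      by (rule sum_of_bool_mult_left[OF f(1)])
    thus "(1 - u) * of_bool (x = y) + (\<Sum>e\<in>set es. u * of_bool (snd x = e) * of_bool (e = snd y))
        = (1 - u) * of_bool (x = y) + u * of_bool (snd x = snd y)"
      by (simp add: es mult.left_commute mult.assoc)
  qed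
  have B'B: "(1 - u) \<cdot>\<^sub>m 1\<^sub>m (length es) + ?B' * ?B
      = (1 + (of_nat r - 1) * u) \<cdot>\<^sub>m 1\<^sub>m (length es)"
    unfolding kernel_mat_scalar[OF es(1)] kernel_mat_mult[OF xs(1)] kernel_mat_add
  proof (rule kernel_mat_cong)
    fix e e' assume e: "e \<in> set es" "e' \<in> set es"
    have "(\<Sum>y\<in>set xs. of_bool (e = snd y) * (u * of_bool (snd y = e')))
        = (\<Sum>y\<in>flags H. of_bool (snd y = e) * (u * of_bool (e = e')))"
      unfolding xs by (intro sum.cong refl) auto
    also have "\<dots> = of_nat r * (u * of_bool (e = e'))"
      using card_flags_edge[OF reg] e es sum_of_bool_card[OF f(2), of "\<lambda>y. snd y = e", where 'b = complex]
      by (simp add: sum_distrib_right[symmetric])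
    finally show "(1 - u) * of_bool (e = e') + (\<Sum>y\<in>set xs. of_bool (e = snd y) * (u * of_bool (snd y = e')))
        = (1 + (of_nat r - 1) * u) * of_bool (e = e')"
      by (simp add: algebra_simps)
  qed
  show ?thesis
    using det_scaled_one_plus_mult_commute[OF kernel_mat_carrier kernel_mat_carrier, of "1 - u" xs es
        "\<lambda>e x. of_bool (e = snd x)" "\<lambda>x e. u * of_bool (snd x = e)"] u
    unfolding BB' B'B len[symmetric] by (simp add: det_smult)
qed

text \<open>
  The matrix is \<open>1 - u (\<alpha> P - \<beta>) Q\<close> for the matrices \<open>P\<close>, \<open>Q\<close> of "same hyperedge" and "same
  hypervertex": the entry of \<open>P Q\<close> at \<open>(y, z)\<close> tells whether the hypervertex of \<open>z\<close> lies on the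
  hyperedge of \<open>y\<close>. As \<open>Q\<close> factors through the functions on hypervertices, the
  determinant is that of \<open>1 - u (\<alpha> (A + d) - \<beta> d)\<close> there.
\<close>

lemma det_same_vertex_kernel:
  fixes u \<alpha> \<beta> :: complex
  assumes fin: "finite_hypergraph H" and reg: "regular_hypergraph d r H"
    and xs: "distinct xs" "set xs = flags H"
    and char: "char_poly (adj_matrix H) = (\<Prod>a\<leftarrow>as. [:- a, 1:])"
  shows "det (kernel_mat xs xs (\<lambda>y z. of_bool (y = z)
      - u * \<alpha> * of_bool (fst z \<in> ends H (snd y)) + u * \<beta> * of_bool (fst y = fst z)))
    = (\<Prod>a\<leftarrow>as. 1 + u * \<beta> * of_nat d - u * \<alpha> * of_nat d - u * \<alpha> * a)"
proof -
  have f: "finite (hverts H)" "finite (flags H)"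
    using fin finite_flags by (auto simp: finite_hypergraph_def)
  define vs where "vs = vert_list H"
  have vs: "distinct vs" "set vs = hverts H" "length vs = card (hverts H)"
    using vert_list[OF fin] by (auto simp: vs_def)
  let ?C = "kernel_mat xs vs (\<lambda>y v. - (u * \<alpha>) * of_bool (v \<in> ends H (snd y)) + u * \<beta> * of_bool (fst y = v))"
  let ?C' = "kernel_mat vs xs (\<lambda>v z. of_bool (v = fst z))"
  have "1\<^sub>m (length xs) + ?C * ?C' = kernel_mat xs xs (\<lambda>y z. of_bool (y = z)
      - u * \<alpha> * of_bool (fst z \<in> ends H (snd y)) + u * \<beta> * of_bool (fst y = fst z))"
    unfolding kernel_mat_one[OF xs(1)] kernel_mat_mult[OF vs(1)] kernel_mat_add
  proof (rule kernel_mat_cong)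
    fix y z assume "y \<in> set xs" "z \<in> set xs"
    hence z: "fst z \<in> set vs" using xs fin vs by (auto simp: flags_def finite_hypergraph_def is_hypergraph_def)
    show "(if y = z then 1 else 0) + (\<Sum>v\<in>set vs. (- (u * \<alpha>) * of_bool (v \<in> ends H (snd y)) + u * \<beta> * of_bool (fst y = v)) * of_bool (v = fst z))
      = of_bool (y = z) - u * \<alpha> * of_bool (fst z \<in> ends H (snd y)) + u * \<beta> * of_bool (fst y = fst z)"
      using sum_of_bool_mult_left(2)[OF _ z, of "\<lambda>v. - (u * \<alpha>) * of_bool (v \<in> ends H (snd y)) + u * \<beta> * of_bool (fst y = v)"]
      by (simp add: mult.commute of_bool_def)
  qed
  moreover have "1\<^sub>m (length vs) + ?C' * ?C
      = (1 + u * \<beta> * of_nat d - u * \<alpha> * of_nat d) \<cdot>\<^sub>m 1\<^sub>m (length vs) - (u * \<alpha>) \<cdot>\<^sub>m adj_matrix H"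
    unfolding adj_matrix_eq_kernel_mat[OF fin] vs_def[symmetric]
      kernel_mat_one[OF vs(1)] kernel_mat_mult[OF xs(1)] kernel_mat_add kernel_mat_smult kernel_mat_minus
  proof (rule kernel_mat_cong)
    fix v w assume vw: "v \<in> set vs" "w \<in> set vs"
    have "(\<Sum>y\<in>set xs. of_bool (v = fst y) * (- (u * \<alpha>) * of_bool (w \<in> ends H (snd y)) + u * \<beta> * of_bool (fst y = w)))
        = (\<Sum>y\<in>flags H. - (u * \<alpha>) * of_bool (fst y = v \<and> w \<in> ends H (snd y))
            + u * \<beta> * of_bool (v = w) * of_bool (fst y = v))"
      unfolding xs by (intro sum.cong refl) auto
    also have "\<dots> = - (u * \<alpha>) * of_nat (adj_entry H v w + (if v = w then d else 0)) + u * \<beta> * of_bool (v = w) * of_nat d"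
      using vw vs card_flags_vert_pair[OF reg, of v w] card_flags_vert[OF reg, of v]
      by (simp only: sum.distrib sum_distrib_left[symmetric] sum_of_bool_card[OF f(2)])
    finally have S: "(\<Sum>y\<in>set xs. of_bool (v = fst y) * (- (u * \<alpha>) * of_bool (w \<in> ends H (snd y)) + u * \<beta> * of_bool (fst y = w)))
        = - (u * \<alpha>) * of_nat (adj_entry H v w + (if v = w then d else 0)) + u * \<beta> * of_bool (v = w) * of_nat d" .
    show "(if v = w then 1 else 0) + (\<Sum>y\<in>set xs. of_bool (v = fst y) * (- (u * \<alpha>) * of_bool (w \<in> ends H (snd y)) + u * \<beta> * of_bool (fst y = w)))
      = (1 + u * \<beta> * of_nat d - u * \<alpha> * of_nat d) * (if v = w then 1 else 0) - u * \<alpha> * of_nat (adj_entry H v w)"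
      unfolding S by (simp add: algebra_simps)
  qed
  moreover have "adj_matrix H \<in> carrier_mat (length vs) (length vs)" by (simp add: adj_matrix_def vs)
  ultimately show ?thesis
    using det_one_plus_mult_commute[of ?C "length xs" "length vs" ?C'] det_scaled_one_minus_eq_prod[OF _ char]
    by simp
qed

text \<open>
  With \<open>G = (1 - u) + u P\<close> one has \<open>1 - u (P - 1) (Q - 1) = G - u (P - 1) Q\<close>. The numbers \<open>\<alpha>\<close> and \<open>\<beta>\<close>
  solve \<open>G (\<alpha> P - \<beta>) = P - 1\<close>, using \<open>P\<^sup>2 = r P\<close>, so that \<open>G\<close> can be split off on the left.
\<close>

lemma flag_step_matrix_factorization:
  fixes u :: complex
  assumes fin: "finite_hypergraph H" and reg: "regular_hypergraph d r H"
    and xs: "distinct xs" "set xs = flags H"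
    and u: "u \<noteq> 1" "1 + (of_nat r - 1) * u \<noteq> 0"
  defines "\<beta> \<equiv> 1 / (1 - u)" and "\<alpha> \<equiv> 1 / ((1 - u) * (1 + (of_nat r - 1) * u))"
  shows "1\<^sub>m (length xs) - u \<cdot>\<^sub>m kernel_mat xs xs (\<lambda>x y. of_bool (flag_step H x y)) =
    kernel_mat xs xs (\<lambda>x y. (1 - u) * of_bool (x = y) + u * of_bool (snd x = snd y)) *
    kernel_mat xs xs (\<lambda>y z. of_bool (y = z)
      - u * \<alpha> * of_bool (fst z \<in> ends H (snd y)) + u * \<beta> * of_bool (fst y = fst z))"
  unfolding kernel_mat_one[OF xs(1)] kernel_mat_mult[OF xs(1)] kernel_mat_smult kernel_mat_minus
proof (rule kernel_mat_cong)
  fix x z assume xz: "x \<in> set xs" "z \<in> set xs"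
  have f: "finite (flags H)" using fin by (rule finite_flags)
  have x: "x \<in> flags H" and z: "z \<in> flags H" using xz xs by auto
  hence xe: "snd x \<in> hedges H" by (auto simp: flags_def)
  have \<beta>: "(1 - u) * \<beta> = 1" and \<alpha>: "(1 - u) * \<alpha> + u * \<alpha> * of_nat r = \<beta>"
  proof -
    show "(1 - u) * \<beta> = 1" using u by (simp add: \<beta>_def)
    have "(1 - u) * \<alpha> + u * \<alpha> * of_nat r = \<alpha> * (1 + (of_nat r - 1) * u)" by (simp add: algebra_simps)
    also have "\<dots> = \<beta>" using u by (simp add: \<alpha>_def \<beta>_def)
    finally show "(1 - u) * \<alpha> + u * \<alpha> * of_nat r = \<beta>" .
  qed
  let ?Y = "\<lambda>y z. of_bool (y = z) - u * \<alpha> * of_bool (fst z \<in> ends H (snd y)) + u * \<beta> * of_bool (fst y = fst z)"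
  have same: "(\<Sum>y\<in>flags H. of_bool (snd x = snd y) * ?Y y z) = of_bool (snd x = snd z)
      - u * \<alpha> * (of_nat r * of_bool (fst z \<in> ends H (snd x))) + u * \<beta> * of_bool (fst z \<in> ends H (snd x))"
  proof -
    have "(\<Sum>y\<in>flags H. of_bool (snd x = snd y) * ?Y y z) =
        (\<Sum>y\<in>flags H. of_bool (y = z) * of_bool (snd x = snd y))
        - u * \<alpha> * ((\<Sum>y\<in>flags H. of_bool (snd y = snd x)) * of_bool (fst z \<in> ends H (snd x)))
        + u * \<beta> * (\<Sum>y\<in>flags H. of_bool (y = (fst z, snd x)))"
      unfolding sum_distrib_left sum_distrib_right sum.distrib[symmetric] sum_subtractf[symmetric]
      by (intro sum.cong refl) (auto simp: prod_eq_iff)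
    also have "(\<Sum>y\<in>flags H. of_bool (snd y = snd x) :: complex) = of_nat r"
      by (simp only: sum_of_bool_card[OF f] card_flags_edge[OF reg xe])
    also have "(\<Sum>y\<in>flags H. of_bool (y = (fst z, snd x)) :: complex) = of_bool (fst z \<in> ends H (snd x))"
    proof (cases "(fst z, snd x) \<in> flags H")
      case True
      thus ?thesis using sum_of_bool_mult_left(2)[OF f True, of "\<lambda>_. 1 :: complex"]
        by (simp add: flags_def)
    next
      case False
      hence "(\<Sum>y\<in>flags H. of_bool (y = (fst z, snd x)) :: complex) = 0" by (intro sum.neutral) auto
      with False x show ?thesis by (auto simp: flags_def)
    qed
    finally show ?thesis by (simp only: sum_of_bool_mult_left(2)[OF f z])
  qed
  have "(\<Sum>y\<in>flags H. ((1 - u) * of_bool (x = y) + u * of_bool (snd x = snd y)) * ?Y y z)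
      = (1 - u) * (\<Sum>y\<in>flags H. of_bool (x = y) * ?Y y z) + u * (\<Sum>y\<in>flags H. of_bool (snd x = snd y) * ?Y y z)"
    by (simp only: sum_distrib_left sum.distrib[symmetric] distrib_right mult.assoc)
  also have "(\<Sum>y\<in>flags H. of_bool (x = y) * ?Y y z) = ?Y x z"
    by (rule sum_of_bool_mult_left(1)[OF f x])
  also have "(1 - u) * ?Y x z + u * (\<Sum>y\<in>flags H. of_bool (snd x = snd y) * ?Y y z)
    = (1 - u) * of_bool (x = z) + u * of_bool (snd x = snd z) + u * ((1 - u) * \<beta>) * of_bool (fst x = fst z)
      - (u * ((1 - u) * \<alpha> + u * \<alpha> * of_nat r) - u * u * \<beta>) * of_bool (fst z \<in> ends H (snd x))"
    unfolding same by (simp add: algebra_simps)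
  also have "u * ((1 - u) * \<alpha> + u * \<alpha> * of_nat r) - u * u * \<beta> = u * ((1 - u) * \<beta>)"
    unfolding \<alpha> by (simp add: algebra_simps)
  also have "(1 - u) * of_bool (x = z) + u * of_bool (snd x = snd z) + u * ((1 - u) * \<beta>) * of_bool (fst x = fst z)
      - u * ((1 - u) * \<beta>) * of_bool (fst z \<in> ends H (snd x))
      = (if x = z then 1 else 0) - u * of_bool (flag_step H x z)"
    unfolding \<beta> using x z by (cases x; cases z) (auto simp: flag_step_def flags_def)
  finally show "(if x = z then 1 else 0) - u * of_bool (flag_step H x z)
    = (\<Sum>y\<in>set xs. ((1 - u) * of_bool (x = y) + u * of_bool (snd x = snd y)) * ?Y y z)"
    by (simp add: xs)
qed

text \<open>
  The powers on the left clear the denominators; dividing by them gives the determinant for all small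
  \<open>u\<close>, which is all that is needed to identify a rational function.
\<close>

theorem det_flag_step_matrix:
  fixes u :: complex
  assumes fin: "finite_hypergraph H" and reg: "regular_hypergraph d r H"
    and xs: "distinct xs" "set xs = flags H"
    and u: "u \<noteq> 1" "1 + (of_nat r - 1) * u \<noteq> 0"
    and char: "char_poly (adj_matrix H) = (\<Prod>a\<leftarrow>as. [:- a, 1:])"
  shows "(1 - u) ^ (card (hverts H) + card (hedges H)) * (1 + (of_nat r - 1) * u) ^ card (hverts H) *
      det (1\<^sub>m (length xs) - u \<cdot>\<^sub>m kernel_mat xs xs (\<lambda>x y. of_bool (flag_step H x y)))
    = (1 - u) ^ card (flags H) * (1 + (of_nat r - 1) * u) ^ card (hedges H) *
      (\<Prod>a\<leftarrow>as. 1 - (a - of_nat r + 2) * u + (of_nat d - 1) * (of_nat r - 1) * u ^ 2)"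
proof -
  let ?b = "1 - u" and ?a = "1 + (of_nat r - 1) * u"
  let ?n1 = "card (hverts H)" and ?n2 = "card (hedges H)"
  define \<beta> \<alpha> where "\<beta> = 1 / ?b" and "\<alpha> = 1 / (?b * ?a)"
  have len: "length xs = card (flags H)" using distinct_card[OF xs(1)] xs(2) by simp
  have adj: "adj_matrix H \<in> carrier_mat ?n1 ?n1" by (simp add: adj_matrix_def)
  have las: "length as = ?n1"
    using degree_monic_char_poly[OF adj] unfolding char
    by (simp add: degree_linear_factors)
  let ?G = "kernel_mat xs xs (\<lambda>x y. (1 - u) * of_bool (x = y) + u * of_bool (snd x = snd y))"
  let ?Y = "kernel_mat xs xs (\<lambda>y z. of_bool (y = z)
      - u * \<alpha> * of_bool (fst z \<in> ends H (snd y)) + u * \<beta> * of_bool (fst y = fst z))"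
  let ?D = "det (1\<^sub>m (length xs) - u \<cdot>\<^sub>m kernel_mat xs xs (\<lambda>x y. of_bool (flag_step H x y)))"
  have D: "?D = det ?G * det ?Y"
    using flag_step_matrix_factorization[OF fin reg xs u] det_mult[of ?G "length xs" ?Y]
    by (simp add: \<alpha>_def \<beta>_def)
  have "(?b * ?a) ^ ?n1 * det ?Y = (\<Prod>a\<leftarrow>as. (?b * ?a) * (1 + u * \<beta> * of_nat d - u * \<alpha> * of_nat d - u * \<alpha> * a))"
    unfolding det_same_vertex_kernel[OF fin reg xs char] las[symmetric]
    by (induction as) (simp_all add: mult_ac)
  also have "(\<lambda>a. (?b * ?a) * (1 + u * \<beta> * of_nat d - u * \<alpha> * of_nat d - u * \<alpha> * a))
      = (\<lambda>a. 1 - (a - of_nat r + 2) * u + (of_nat d - 1) * (of_nat r - 1) * u ^ 2)"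
  proof
    fix a
    have 1: "?b * ?a * \<beta> = ?a" "?b * ?a * \<alpha> = 1" using u by (simp_all add: \<alpha>_def \<beta>_def)
    have "(?b * ?a) * (1 + u * \<beta> * of_nat d - u * \<alpha> * of_nat d - u * \<alpha> * a)
        = ?b * ?a + u * (?b * ?a * \<beta>) * of_nat d - u * (?b * ?a * \<alpha>) * of_nat d - u * (?b * ?a * \<alpha>) * a"
      by (simp add: algebra_simps)
    also have "\<dots> = 1 - (a - of_nat r + 2) * u + (of_nat d - 1) * (of_nat r - 1) * u ^ 2"
      unfolding 1 by (simp add: algebra_simps power2_eq_square)
    finally show "(?b * ?a) * (1 + u * \<beta> * of_nat d - u * \<alpha> * of_nat d - u * \<alpha> * a)
        = 1 - (a - of_nat r + 2) * u + (of_nat d - 1) * (of_nat r - 1) * u ^ 2" .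
  qed
  finally have Y: "(?b * ?a) ^ ?n1 * det ?Y =
    (\<Prod>a\<leftarrow>as. 1 - (a - of_nat r + 2) * u + (of_nat d - 1) * (of_nat r - 1) * u ^ 2)" .
  have "?b ^ (?n1 + ?n2) * ?a ^ ?n1 * ?D =
      (?b ^ ?n2 * det ?G) * ((?b * ?a) ^ ?n1 * det ?Y)"
    unfolding D power_add power_mult_distrib by (simp only: mult_ac)
  also have "\<dots> = ?b ^ card (flags H) * ?a ^ ?n2 *
      (\<Prod>a\<leftarrow>as. 1 - (a - of_nat r + 2) * u + (of_nat d - 1) * (of_nat r - 1) * u ^ 2)"
    unfolding Y det_same_edge_kernel[OF fin reg xs u(1)] len by (simp only: mult_ac)
  finally show ?thesis .
qed

section \<open>The adjacency spectrum\<close>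

text \<open>
  Connectedness of the bipartite graph, phrased as propagation along hyperedges.
\<close>

lemma connected_hypergraph_induct:
  fixes H :: "('v, 'e) hypergraph"
  assumes conn: "connected_hypergraph H" and H: "is_hypergraph H"
    and v0: "v0 \<in> hverts H" "P v0"
    and step: "\<And>e v w. e \<in> hedges H \<Longrightarrow> v \<in> ends H e \<Longrightarrow> w \<in> ends H e \<Longrightarrow> P v \<Longrightarrow> P w"
    and v: "v \<in> hverts H"
  shows "P v"
proof -
  let ?G = "with_proj (mk_symmetric (with_proj (bip_graph H)))"
  have ends: "arcs_ends ?G \<subseteq> parcs (bip_graph H)"
  proof
    fix a assume "a \<in> arcs_ends ?G"
    hence "a \<in> parcs (bip_graph H) \<or> (snd a, fst a) \<in> parcs (bip_graph H)"
      by (auto simp: arcs_ends_conv mk_symmetric_def)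
    thus "a \<in> parcs (bip_graph H)" by (cases a) (auto simp: bip_graph_def)
  qed
  have "Inl v0 \<in> verts ?G" "Inl v \<in> verts ?G"
    using v0(1) v by (simp_all add: mk_symmetric_def bip_graph_def InlI)
  hence "(Inl v0, Inl v) \<in> rtrancl_on (verts ?G) (arcs_ends ?G)"
    using conn by (simp add: connected_hypergraph_def connected_def strongly_connected_def reachable_def)
  hence "case (Inl v :: 'v + 'e) of Inl v \<Rightarrow> P v | Inr e \<Rightarrow> (\<forall>v\<in>ends H e. P v)"
  proof (rule rtrancl_on_induct)
    show "case (Inl v0 :: 'v + 'e) of Inl v \<Rightarrow> P v | Inr e \<Rightarrow> (\<forall>v\<in>ends H e. P v)"
      using v0(2) by simp
    fix x y :: "'v + 'e"
    assume "(x, y) \<in> arcs_ends ?G"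
      and Px: "case x of Inl v \<Rightarrow> P v | Inr e \<Rightarrow> (\<forall>v\<in>ends H e. P v)"
    hence "(x, y) \<in> parcs (bip_graph H)" using ends by blast
    then obtain e w where e: "e \<in> hedges H" "w \<in> ends H e"
      and xy: "x = Inl w \<and> y = Inr e \<or> x = Inr e \<and> y = Inl w"
      by (auto simp: bip_graph_def)
    show "case y of Inl v \<Rightarrow> P v | Inr e \<Rightarrow> (\<forall>v\<in>ends H e. P v)"
      using xy
    proof
      assume "x = Inl w \<and> y = Inr e"
      thus ?thesis using Px step[OF e(1,2)] by simp
    next
      assume "x = Inr e \<and> y = Inl w"
      thus ?thesis using Px e(2) by simp
    qed
  qed
  thus ?thesis by simp
qed

lemma Spec_eigenfunction:
  assumes fin: "finite_hypergraph H" and x: "x \<in> Spec H"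
  obtains f where "\<exists>v\<in>hverts H. f v \<noteq> 0"
    and "\<And>v. v \<in> hverts H \<Longrightarrow> (\<Sum>w\<in>hverts H. of_nat (adj_entry H v w) * f w) = x * f v"
proof -
  define vs where "vs = vert_list H"
  have vs: "distinct vs" "set vs = hverts H" using vert_list[OF fin] by (auto simp: vs_def)
  have A: "adj_matrix H = kernel_mat vs vs (\<lambda>v w. of_nat (adj_entry H v w))"
    unfolding vs_def by (rule adj_matrix_eq_kernel_mat[OF fin])
  obtain y where y: "y \<in> carrier_vec (length vs)" "y \<noteq> 0\<^sub>v (length vs)" "adj_matrix H *\<^sub>v y = x \<cdot>\<^sub>v y"
    using x by (auto simp: Spec_def spectrum_def eigenvalue_def eigenvector_def A kernel_mat_def)
  define f where "f v = y $ (the_inv_into {..<length vs} ((!) vs) v)" for v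
  have f: "f (vs ! i) = y $ i" if "i < length vs" for i
    unfolding f_def using that vs(1) by (subst the_inv_into_f_f) (auto simp: inj_on_nth)
  show ?thesis
  proof (rule that[of f])
    have "\<exists>i<length vs. y $ i \<noteq> 0"
    proof (rule ccontr)
      assume "\<not> ?thesis"
      hence "y = 0\<^sub>v (length vs)" using y(1) by (intro eq_vecI) auto
      with y(2) show False ..
    qed
    then obtain i where i: "i < length vs" "y $ i \<noteq> 0" by blast
    hence "vs ! i \<in> hverts H" "f (vs ! i) \<noteq> 0" using f[OF i(1)] nth_mem[OF i(1)] vs(2) by auto
    thus "\<exists>v\<in>hverts H. f v \<noteq> 0" by blast
  next
    fix v assume "v \<in> hverts H"
    then obtain i where i: "i < length vs" "v = vs ! i" using vs(2) by (metis in_set_conv_nth)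
    have "(\<Sum>w\<in>hverts H. of_nat (adj_entry H v w) * f w)
        = (\<Sum>j<length vs. of_nat (adj_entry H v (vs ! j)) * f (vs ! j))"
      unfolding vs(2)[symmetric] by (rule sum_nth_distinct[OF vs(1), symmetric])
    also have "\<dots> = (adj_matrix H *\<^sub>v y) $ i"
      using i y(1) f by (auto simp: A scalar_prod_def kernel_mat_def atLeast0LessThan intro!: sum.cong)
    also have "\<dots> = x * f v" using i y f by simp
    finally show "(\<Sum>w\<in>hverts H. of_nat (adj_entry H v w) * f w) = x * f v" .
  qed
qed

text \<open>
  This is \<open>\<langle>(A + d) f, f\<rangle> = |M\<^sup>T f|\<^sup>2\<close>, where \<open>M\<close> is the incidence matrix and \<open>A + d = M M\<^sup>T\<close>; the entry of
  \<open>M\<^sup>T f\<close> at a hyperedge is the sum of \<open>f\<close> over it.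
\<close>

lemma eigenfunction_quadratic_form:
  assumes fin: "finite_hypergraph H" and reg: "regular_hypergraph d r H"
    and eig: "\<And>v. v \<in> hverts H \<Longrightarrow> (\<Sum>w\<in>hverts H. of_nat (adj_entry H v w) * f w) = x * f v"
  shows "(x + of_nat d) * of_real (\<Sum>v\<in>hverts H. (cmod (f v))\<^sup>2)
    = of_real (\<Sum>e\<in>hedges H. (cmod (\<Sum>v\<in>ends H e. f v))\<^sup>2)"
proof -
  have f: "finite (hverts H)" "finite (hedges H)" using fin by (auto simp: finite_hypergraph_def)
  have sub: "ends H e \<subseteq> hverts H" if "e \<in> hedges H" for e
    using fin that by (auto simp: finite_hypergraph_def is_hypergraph_def)
  have ends_sum: "(\<Sum>v\<in>ends H e. h v) = (\<Sum>v\<in>hverts H. of_bool (v \<in> ends H e) * h v)"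
    if "e \<in> hedges H" for e and h :: "'a \<Rightarrow> complex"
    using sub[OF that] f by (intro sum.mono_neutral_cong_left) auto
  have "(\<Sum>e\<in>hedges H. of_bool (v \<in> ends H e) * (\<Sum>w\<in>ends H e. f w)) = (x + of_nat d) * f v"
    if v: "v \<in> hverts H" for v
  proof -
    have "(\<Sum>e\<in>hedges H. of_bool (v \<in> ends H e) * (\<Sum>w\<in>ends H e. f w))
        = (\<Sum>e\<in>hedges H. \<Sum>w\<in>hverts H. of_bool (v \<in> ends H e \<and> w \<in> ends H e) * f w)"
      by (intro sum.cong refl) (auto simp: ends_sum sum_distrib_left intro!: sum.cong)
    also have "\<dots> = (\<Sum>w\<in>hverts H. (\<Sum>e\<in>hedges H. of_bool (v \<in> ends H e \<and> w \<in> ends H e)) * f w)"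
      by (subst sum.swap) (simp only: sum_distrib_right)
    also have "\<dots> = (\<Sum>w\<in>hverts H. of_nat (adj_entry H v w) * f w + of_bool (v = w) * (of_nat d * f w))"
    proof (intro sum.cong refl)
      fix w
      have "card {e \<in> hedges H. v \<in> ends H e \<and> w \<in> ends H e} = adj_entry H v w + (if v = w then d else 0)"
        using reg v by (auto simp: adj_entry_eq regular_hypergraph_def)
      thus "(\<Sum>e\<in>hedges H. of_bool (v \<in> ends H e \<and> w \<in> ends H e)) * f w
          = of_nat (adj_entry H v w) * f w + of_bool (v = w) * (of_nat d * f w)"
        by (simp only: sum_of_bool_card[OF f(2)]) (simp add: algebra_simps)
    qed
    also have "\<dots> = (x + of_nat d) * f v"
      using sum_of_bool_mult_left(1)[OF f(1) v, of "\<lambda>w. of_nat d * f w"]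
      by (simp only: sum.distrib eig[OF v]) (simp add: algebra_simps)
    finally show ?thesis .
  qed
  hence "(\<Sum>v\<in>hverts H. cnj (f v) * ((x + of_nat d) * f v))
      = (\<Sum>v\<in>hverts H. cnj (f v) * (\<Sum>e\<in>hedges H. of_bool (v \<in> ends H e) * (\<Sum>w\<in>ends H e. f w)))"
    by (intro sum.cong refl) simp
  also have "\<dots> = (\<Sum>v\<in>hverts H. \<Sum>e\<in>hedges H. of_bool (v \<in> ends H e) * cnj (f v) * (\<Sum>w\<in>ends H e. f w))"
    by (simp add: sum_distrib_left mult_ac)
  also have "\<dots> = (\<Sum>e\<in>hedges H. (\<Sum>v\<in>hverts H. of_bool (v \<in> ends H e) * cnj (f v)) * (\<Sum>w\<in>ends H e. f w))"
    by (subst sum.swap) (simp only: sum_distrib_right)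
  also have "\<dots> = (\<Sum>e\<in>hedges H. of_real ((cmod (\<Sum>v\<in>ends H e. f v))\<^sup>2))"
  proof (intro sum.cong refl)
    fix e assume e: "e \<in> hedges H"
    have "(\<Sum>v\<in>hverts H. of_bool (v \<in> ends H e) * cnj (f v)) = cnj (\<Sum>v\<in>ends H e. f v)"
      using ends_sum[OF e, of "\<lambda>v. cnj (f v)"] by simp
    thus "(\<Sum>v\<in>hverts H. of_bool (v \<in> ends H e) * cnj (f v)) * (\<Sum>w\<in>ends H e. f w)
        = of_real ((cmod (\<Sum>v\<in>ends H e. f v))\<^sup>2)"
      by (simp only: complex_norm_square mult.commute)
  qed
  also have "(\<Sum>v\<in>hverts H. cnj (f v) * ((x + of_nat d) * f v)) =
      (x + of_nat d) * (\<Sum>v\<in>hverts H. of_real ((cmod (f v))\<^sup>2))"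
    unfolding sum_distrib_left complex_norm_square by (simp only: mult_ac)
  finally show ?thesis by simp
qed

text \<open>
  By Cauchy-Schwarz on each hyperedge; every hypervertex then occurs in \<open>d\<close> of the sums.
\<close>

lemma edge_sums_bound:
  assumes fin: "finite_hypergraph H" and reg: "regular_hypergraph d r H"
  shows "(\<Sum>e\<in>hedges H. (cmod (\<Sum>v\<in>ends H e. f v))\<^sup>2) \<le> real d * real r * (\<Sum>v\<in>hverts H. (cmod (f v))\<^sup>2)"
proof -
  have f: "finite (hverts H)" "finite (hedges H)" using fin by (auto simp: finite_hypergraph_def)
  have sub: "ends H e \<subseteq> hverts H" if "e \<in> hedges H" for e
    using fin that by (auto simp: finite_hypergraph_def is_hypergraph_def)
  have "(\<Sum>e\<in>hedges H. (cmod (\<Sum>v\<in>ends H e. f v))\<^sup>2)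
      \<le> (\<Sum>e\<in>hedges H. real r * (\<Sum>v\<in>hverts H. of_bool (v \<in> ends H e) * (cmod (f v))\<^sup>2))"
  proof (intro sum_mono)
    fix e assume e: "e \<in> hedges H"
    have fe: "finite (ends H e)" using sub[OF e] f finite_subset by blast
    have "(cmod (\<Sum>v\<in>ends H e. f v))\<^sup>2 \<le> (\<Sum>v\<in>ends H e. cmod (f v))\<^sup>2"
      by (intro power_mono norm_sum) simp
    also have "\<dots> \<le> (\<Sum>v\<in>ends H e. (cmod (f v))\<^sup>2) * card (ends H e)"
      by (rule sum_squared_le_sum_of_squares)
    also have "\<dots> = real r * (\<Sum>v\<in>ends H e. (cmod (f v))\<^sup>2)"
      using reg e by (simp add: regular_hypergraph_def)
    also have "(\<Sum>v\<in>ends H e. (cmod (f v))\<^sup>2) = (\<Sum>v\<in>hverts H. of_bool (v \<in> ends H e) * (cmod (f v))\<^sup>2)"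
      using sub[OF e] f by (intro sum.mono_neutral_cong_left) auto
    finally show "(cmod (\<Sum>v\<in>ends H e. f v))\<^sup>2 \<le> real r * (\<Sum>v\<in>hverts H. of_bool (v \<in> ends H e) * (cmod (f v))\<^sup>2)" .
  qed
  also have "\<dots> = real r * (\<Sum>v\<in>hverts H. (\<Sum>e\<in>hedges H. of_bool (v \<in> ends H e)) * (cmod (f v))\<^sup>2)"
    unfolding sum_distrib_left[symmetric] sum_distrib_right by (subst sum.swap) simp
  also have "(\<Sum>v\<in>hverts H. (\<Sum>e\<in>hedges H. of_bool (v \<in> ends H e)) * (cmod (f v))\<^sup>2)
      = (\<Sum>v\<in>hverts H. real d * (cmod (f v))\<^sup>2)"
    using reg by (intro sum.cong refl) (simp only: sum_of_bool_card[OF f(2)] regular_hypergraph_def)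
  finally show ?thesis by (simp add: sum_distrib_left mult_ac)
qed

text \<open>
  Divide the quadratic form by \<open>|f|\<^sup>2\<close>: the quotient is a real number between \<open>0\<close> and \<open>d r\<close>.
\<close>

lemma Spec_real_bounds:
  assumes fin: "finite_hypergraph H" and reg: "regular_hypergraph d r H" and x: "x \<in> Spec H"
  obtains t :: real where "x = of_real t" "- real d \<le> t" "t \<le> real d * (real r - 1)"
proof -
  obtain f where nz: "\<exists>v\<in>hverts H. f v \<noteq> 0"
    and eig: "\<And>v. v \<in> hverts H \<Longrightarrow> (\<Sum>w\<in>hverts H. of_nat (adj_entry H v w) * f w) = x * f v"
    using Spec_eigenfunction[OF fin x] by blast
  define F where "F = (\<Sum>v\<in>hverts H. (cmod (f v))\<^sup>2)"
  define E where "E = (\<Sum>e\<in>hedges H. (cmod (\<Sum>v\<in>ends H e. f v))\<^sup>2)"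
  obtain v where v: "v \<in> hverts H" "f v \<noteq> 0" using nz by blast
  have F: "F > 0"
    unfolding F_def using fin v by (intro sum_pos2[of _ v]) (auto simp: finite_hypergraph_def)
  have "(x + of_nat d) * of_real F = of_real E"
    unfolding F_def E_def by (rule eigenfunction_quadratic_form[OF fin reg eig])
  hence "x + of_nat d = of_real E / of_real F" using F by (simp add: nonzero_eq_divide_eq)
  hence "x = of_real (E / F - real d)" by (simp add: algebra_simps)
  moreover have "E / F \<ge> 0" using F unfolding E_def by (intro divide_nonneg_nonneg sum_nonneg) auto
  moreover have "E / F \<le> real d * real r"
    using edge_sums_bound[OF fin reg, of f] F unfolding E_def F_def by (simp add: divide_le_eq)
  ultimately show ?thesis using that[of "E / F - real d"] by (simp add: algebra_simps)
qed

text \<open>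
  The quadratic form vanishes, so \<open>f\<close> takes opposite values at the two ends of each hyperedge. By
  connectedness \<open>f\<close> has only two values, one the negative of the other, and these are the colours.
\<close>

lemma two_colorable_if_minus_degree_eigenvalue:
  fixes H :: "('v, 'e) hypergraph"
  assumes fin: "finite_hypergraph H" and conn: "connected_hypergraph H"
    and reg: "regular_hypergraph d 2 H" and x: "- of_nat d \<in> Spec H"
  shows "two_colorable H"
proof -
  obtain f :: "'v \<Rightarrow> complex" where nz: "\<exists>v\<in>hverts H. f v \<noteq> 0"
    and eig: "\<And>v. v \<in> hverts H \<Longrightarrow> (\<Sum>w\<in>hverts H. of_nat (adj_entry H v w) * f w) = - of_nat d * f v"
    using Spec_eigenfunction[OF fin x] by blast
  obtain v0 where v0: "v0 \<in> hverts H" "f v0 \<noteq> 0" using nz by blast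
  have "of_real (\<Sum>e\<in>hedges H. (cmod (\<Sum>v\<in>ends H e. f v))\<^sup>2) = (0 :: complex)"
    using eigenfunction_quadratic_form[OF fin reg eig] by simp
  hence "(\<Sum>e\<in>hedges H. (cmod (\<Sum>v\<in>ends H e. f v))\<^sup>2) = 0" by (simp only: of_real_eq_0_iff)
  hence zero: "\<forall>e\<in>hedges H. (\<Sum>v\<in>ends H e. f v) = 0"
    using fin by (subst (asm) sum_nonneg_eq_0_iff) (auto simp: finite_hypergraph_def)
  have alt: "\<exists>v w. ends H e = {v, w} \<and> v \<noteq> w \<and> f w = - f v" if "e \<in> hedges H" for e
  proof -
    have "card (ends H e) = 2" using reg that by (simp add: regular_hypergraph_def)
    then obtain v w where vw: "ends H e = {v, w}" "v \<noteq> w" by (auto simp: card_2_iff)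
    moreover have "(\<Sum>v\<in>ends H e. f v) = 0" using zero that by blast
    hence "f w = - f v" using vw by (simp add: add_eq_0_iff)
    ultimately show ?thesis by blast
  qed
  have "f v = f v0 \<or> f v = - f v0" if "v \<in> hverts H" for v
  proof (rule connected_hypergraph_induct[where P = "\<lambda>v. f v = f v0 \<or> f v = - f v0", OF conn _ v0(1) _ _ that])
    show "is_hypergraph H" using fin by (simp add: finite_hypergraph_def)
    fix e v w assume "e \<in> hedges H" "v \<in> ends H e" "w \<in> ends H e" "f v = f v0 \<or> f v = - f v0"
    thus "f w = f v0 \<or> f w = - f v0" using alt[of e] by auto
  qed simp
  hence pm: "f v = f v0 \<or> f v = - f v0" if "e \<in> hedges H" "v \<in> ends H e" for e v
    using that fin by (auto simp: finite_hypergraph_def is_hypergraph_def)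
  have "\<exists>v\<in>ends H e. \<exists>w\<in>ends H e. (f v = f v0) \<noteq> (f w = f v0)" if e: "e \<in> hedges H" for e
  proof -
    obtain v w where vw: "ends H e = {v, w}" "f w = - f v" using alt[OF e] by blast
    have "- f v0 \<noteq> f v0" using v0(2) by (simp add: neg_equal_iff_equal)
    hence "(f v = f v0) \<noteq> (f w = f v0)" using pm[OF e, of v] vw by auto
    thus ?thesis using vw(1) by blast
  qed
  hence "\<forall>e\<in>hedges H. \<exists>v\<in>ends H e. \<exists>w\<in>ends H e. (f v = f v0) \<noteq> (f w = f v0)" by simp
  thus ?thesis unfolding two_colorable_def by (rule exI[of _ "\<lambda>v. f v = f v0"])
qed

section \<open>The zeta function as a rational function\<close>

lemma rf_vanishes_to_fract: "rf_vanishes (to_fract p) u \<longleftrightarrow> poly p u = 0"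
  by (simp add: rf_vanishes_def rf_pole_def rf_eval_def)

lemma poly_eq_if_eq_near_0:
  fixes p q :: "complex poly"
  assumes "\<epsilon> > 0" "\<And>u. cmod u < \<epsilon> \<Longrightarrow> poly p u = poly q u"
  shows "p = q"
proof (rule ccontr)
  assume "p \<noteq> q"
  hence "finite {u. poly (p - q) u = 0}" by (intro poly_roots_finite) simp
  moreover have "complex_of_real ` {0<..<\<epsilon>} \<subseteq> {u. poly (p - q) u = 0}"
    using assms(2) by auto
  ultimately have "finite (complex_of_real ` {0<..<\<epsilon>})" by (rule finite_subset[rotated])
  hence "finite {0<..<\<epsilon>}" by (rule finite_imageD) (simp add: inj_on_def)
  with assms(1) show False by (simp add: infinite_Ioo)
qed

lemma euler_product_unique:
  "euler_product H u z \<Longrightarrow> euler_product H u z' \<Longrightarrow> z = z'"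
  unfolding euler_product_def by (rule tendsto_unique[OF finite_subsets_at_top_neq_bot])

text \<open>
  Euler products near \<open>0\<close> determine the rational function, because a nonzero polynomial has only
  finitely many roots.
\<close>

lemma zeta_eq_inverse:
  fixes H :: "('v, 'e) hypergraph" and D :: "complex poly"
  assumes D0: "poly D 0 \<noteq> 0" and \<epsilon>: "\<epsilon> > 0"
    and prod: "\<And>u. cmod u < \<epsilon> \<Longrightarrow> euler_product H u (inverse (poly D u))"
  shows "zeta H = inverse (to_fract D)"
proof -
  have "D \<noteq> 0" using D0 by auto
  have fract: "to_fract (fst (quot_of_fract Z)) = Z * to_fract (snd (quot_of_fract Z))" for Z :: "complex poly fract"
  proof -
    have "Z = to_fract (fst (quot_of_fract Z)) / to_fract (snd (quot_of_fract Z))"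
      by (metis Fract_conv_to_fract Fract_quot_of_fract)
    thus ?thesis by (simp add: field_simps)
  qed
  have "(poly D \<longlongrightarrow> poly D 0) (nhds 0)" by (rule tendsto_poly[OF filterlim_ident, unfolded id_def])
  hence "\<forall>\<^sub>F u in nhds 0. poly D u \<noteq> 0" using D0 by (rule tendsto_imp_eventually_ne)
  then obtain \<delta> where \<delta>: "\<delta> > 0" "\<And>u. cmod u < \<delta> \<Longrightarrow> poly D u \<noteq> 0"
    unfolding eventually_nhds_metric by (auto simp: dist_norm)
  show ?thesis
    unfolding zeta_def
  proof (rule the_equality)
    define a b where "a = fst (quot_of_fract (inverse (to_fract D)))" and "b = snd (quot_of_fract (inverse (to_fract D)))"
    have "to_fract (D * a) = to_fract b"
      using fract[of "inverse (to_fract D)"] \<open>D \<noteq> 0\<close> by (simp add: a_def b_def)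
    hence Dab: "D * a = b" by (simp only: to_fract_eq_iff)
    hence "a dvd b" by auto
    moreover have "coprime a b" unfolding a_def b_def by (rule coprime_quot_of_fract)
    \<comment> \<open>So the reduced numerator of \<open>1/D\<close> is constant, and the reduced denominator
      vanishes only where \<open>D\<close> does.\<close>
    ultimately have "is_unit a" by (metis coprime_common_divisor dvd_refl)
    then obtain c where "a = [:c:]" "is_unit c" by (rule is_unit_polyE)
    hence a: "poly a u \<noteq> 0" for u by auto
    show "\<exists>\<epsilon>>0. \<forall>u. cmod u < \<epsilon> \<longrightarrow> \<not> rf_pole (inverse (to_fract D)) u \<and>
        euler_product H u (rf_eval (inverse (to_fract D)) u)"
    proof (rule exI[of _ "min \<epsilon> \<delta>"], intro conjI allI impI)
      show "min \<epsilon> \<delta> > 0" using \<epsilon> \<delta> by simp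
      fix u :: complex assume u: "cmod u < min \<epsilon> \<delta>"
      show "\<not> rf_pole (inverse (to_fract D)) u"
        unfolding rf_pole_def b_def[symmetric] Dab[symmetric] using a \<delta>(2)[of u] u by simp
      have "rf_eval (inverse (to_fract D)) u = inverse (poly D u)"
        unfolding rf_eval_def a_def[symmetric] b_def[symmetric] Dab[symmetric]
        using a by (simp add: field_simps)
      thus "euler_product H u (rf_eval (inverse (to_fract D)) u)" using prod[of u] u by simp
    qed
  next
    fix Z assume "\<exists>\<epsilon>>0. \<forall>u. cmod u < \<epsilon> \<longrightarrow> \<not> rf_pole Z u \<and> euler_product H u (rf_eval Z u)"
    then obtain \<epsilon>' where \<epsilon>': "\<epsilon>' > 0"
      and Z: "\<And>u. cmod u < \<epsilon>' \<Longrightarrow> \<not> rf_pole Z u \<and> euler_product H u (rf_eval Z u)" by blast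
    define a b where "a = fst (quot_of_fract Z)" and "b = snd (quot_of_fract Z)"
    have "D * a = b"
    proof (rule poly_eq_if_eq_near_0)
      show "min (min \<epsilon> \<epsilon>') \<delta> > 0" using \<epsilon> \<epsilon>' \<delta>(1) by simp
      fix u :: complex assume u: "cmod u < min (min \<epsilon> \<epsilon>') \<delta>"
      have "rf_eval Z u = inverse (poly D u)"
        using Z[of u] prod[of u] u by (intro euler_product_unique[of H u]) auto
      moreover have "poly b u \<noteq> 0" using Z[of u] u by (simp add: rf_pole_def b_def)
      ultimately show "poly (D * a) u = poly b u"
        using \<delta>(2)[of u] u by (simp add: rf_eval_def a_def[symmetric] b_def[symmetric] field_simps)
    qed
    hence "to_fract D * to_fract a = to_fract b" by (metis to_fract_mult)
    hence "to_fract b * (to_fract D * Z) = to_fract b"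
      using fract[of Z] by (simp add: a_def[symmetric] b_def[symmetric] mult_ac)
    moreover have "to_fract b \<noteq> 0" by (simp add: b_def)
    ultimately have "to_fract D * Z = 1" by simp
    thus "Z = inverse (to_fract D)" by (metis inverse_unique)
  qed
qed

text \<open>
  To be used with the list \<open>as\<close> of adjacency eigenvalues and with \<open>m = N - n\<^sub>1 - n\<^sub>2\<close>, where \<open>N\<close> is the
  number of flags.
\<close>

definition quotient_numerator :: "nat \<Rightarrow> nat \<Rightarrow> complex list \<Rightarrow> nat \<Rightarrow> complex poly" where
  "quotient_numerator d r as m = [:1, -1:] ^ m *
     (\<Prod>a\<leftarrow>as. [:1, - (a - of_nat r + 2), (of_nat d - 1) * (of_nat r - 1):])"

lemma poly_quotient_numerator:
  "poly (quotient_numerator d r as m) u = (1 - u) ^ m *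
    (\<Prod>a\<leftarrow>as. 1 - (a - of_nat r + 2) * u + (of_nat d - 1) * (of_nat r - 1) * u ^ 2)"
proof -
  have "poly (\<Prod>a\<leftarrow>as. [:1, - (a - of_nat r + 2), (of_nat d - 1) * (of_nat r - 1):]) u
      = (\<Prod>a\<leftarrow>as. 1 - (a - of_nat r + 2) * u + (of_nat d - 1) * (of_nat r - 1) * u ^ 2)"
    by (induction as) (simp_all add: power2_eq_square algebra_simps)
  thus ?thesis by (simp add: quotient_numerator_def)
qed

theorem zeta_quotient_eq_poly:
  fixes H :: "('v, 'e) hypergraph"
  assumes fin: "finite_hypergraph H" and reg: "regular_hypergraph d r H"
    and char: "char_poly (adj_matrix H) = (\<Prod>a\<leftarrow>as. [:- a, 1:])"
    and le: "card (hverts H) \<le> card (hedges H)"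
    and m: "card (flags H) = card (hverts H) + card (hedges H) + m"
  shows "to_fract [:1, of_nat r - 1:] powi (int (card (hverts H)) - int (card (hedges H))) / zeta H
    = to_fract (quotient_numerator d r as m)"
proof -
  let ?n1 = "card (hverts H)" and ?n2 = "card (hedges H)"
  define L :: "complex poly" where "L = [:1, of_nat r - 1:]"
  define k where "k = ?n2 - ?n1"
  let ?D = "L ^ k * quotient_numerator d r as m"
  obtain xs where xs: "distinct xs" "set xs = flags H"
    using finite_distinct_list[OF finite_flags[OF fin]] by blast
  obtain \<epsilon> where \<epsilon>: "\<epsilon> > 0" and prod: "\<And>u. cmod u < \<epsilon> \<Longrightarrow>
      euler_product H u (inverse (det (1\<^sub>m (length xs) - u \<cdot>\<^sub>m kernel_mat xs xs (\<lambda>x y. of_bool (flag_step H x y)))))"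
    using euler_product_eq_inverse_det[OF fin xs] by blast
  have "zeta H = inverse (to_fract ?D)"
  proof (rule zeta_eq_inverse)
    show "poly ?D 0 \<noteq> 0" by (auto simp: poly_quotient_numerator L_def prod_list_zero_iff)
    \<comment> \<open>The second radius keeps \<open>u\<close> away from the zeros of \<open>1 - u\<close> and
      \<open>1 + (r - 1) u\<close>, also for \<open>r = 0\<close>.\<close>
    show "min \<epsilon> (1 / (real r + 2)) > 0" using \<epsilon> by simp
    fix u :: complex assume u: "cmod u < min \<epsilon> (1 / (real r + 2))"
    have "cmod ((of_nat r - 1) * u) < 1"
    proof -
      have "cmod (of_nat r - 1) \<le> real r + 1" using norm_triangle_ineq4[of "of_nat r :: complex" 1] by simp
      hence "cmod ((of_nat r - 1) * u) \<le> (real r + 1) * cmod u"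
        by (simp add: norm_mult mult_right_mono)
      also have "\<dots> \<le> (real r + 2) * cmod u" by (intro mult_right_mono) auto
      also have "\<dots> < 1" using u by (simp add: field_simps)
      finally show ?thesis .
    qed
    hence a: "1 + (of_nat r - 1) * u \<noteq> 0"
      by (metis add_eq_0_iff norm_minus_cancel norm_one order_less_irrefl)
    have "1 / (real r + 2) \<le> 1" by simp
    hence b: "u \<noteq> 1" using u by auto
    let ?det = "det (1\<^sub>m (length xs) - u \<cdot>\<^sub>m kernel_mat xs xs (\<lambda>x y. of_bool (flag_step H x y)))"
    have n2: "?n2 = ?n1 + k" using le by (simp add: k_def)
    have "((1 - u) ^ (?n1 + ?n2) * (1 + (of_nat r - 1) * u) ^ ?n1) * ?det
        = ((1 - u) ^ (?n1 + ?n2) * (1 + (of_nat r - 1) * u) ^ ?n1) * poly ?D u"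
      unfolding det_flag_step_matrix[OF fin reg xs b a char] m poly_mult poly_quotient_numerator poly_power
      by (simp add: L_def n2 power_add mult_ac)
    hence "?det = poly ?D u" using a b by simp
    thus "euler_product H u (inverse (poly ?D u))" using prod[of u] u by simp
  qed
  moreover have "to_fract L \<noteq> 0" by (simp add: L_def)
  moreover have "to_fract L powi (int ?n1 - int ?n2) = inverse (to_fract L ^ k)"
    using le by (simp add: power_int_def k_def power_inverse nat_diff_distrib)
  moreover have "to_fract (L ^ k) = to_fract L ^ k"
    by (induction k) simp_all
  ultimately show ?thesis by (simp add: L_def[symmetric] divide_inverse)
qed

section \<open>Roots of the quadratic factors\<close>

text \<open>
  The discriminant is not positive, so the roots are complex conjugates, with product \<open>1/q\<close>.
\<close>

lemma root_norm_if_abs_le: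
  fixes \<mu> q :: real and u :: complex
  assumes q: "q > 0" and \<mu>: "\<bar>\<mu>\<bar> \<le> 2 * sqrt q" and root: "1 - of_real \<mu> * u + of_real q * u\<^sup>2 = 0"
  shows "(cmod u)\<^sup>2 = 1 / q"
proof -
  let ?x = "Re u" and ?y = "Im u"
  have re: "1 - \<mu> * ?x + q * (?x\<^sup>2 - ?y\<^sup>2) = 0" and im: "?y * (2 * q * ?x - \<mu>) = 0"
    using arg_cong[OF root, of Re] arg_cong[OF root, of Im]
    by (simp_all add: power2_eq_square algebra_simps)
  have "q * (?x\<^sup>2 + ?y\<^sup>2) = 1"
  proof (cases "?y = 0")
    case False
    hence "\<mu> = 2 * q * ?x" using im by simp
    with re show ?thesis by (simp add: power2_eq_square algebra_simps)
  next
    case True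
    have "\<mu>\<^sup>2 \<le> (2 * sqrt q)\<^sup>2" using power_mono[OF \<mu>, of 2] by simp
    hence disc: "\<mu>\<^sup>2 \<le> 4 * q" using q by (simp add: power_mult_distrib)
    have sq: "(2 * q * ?x - \<mu>)\<^sup>2 = 4 * q * (1 - \<mu> * ?x + q * ?x\<^sup>2) + (\<mu>\<^sup>2 - 4 * q)"
      by (simp add: power2_eq_square algebra_simps)
    hence eq: "(2 * q * ?x - \<mu>)\<^sup>2 = \<mu>\<^sup>2 - 4 * q" using re True by simp
    hence "(2 * q * ?x - \<mu>)\<^sup>2 = 0" using disc by (smt (verit) zero_le_power2)
    hence "\<mu> = 2 * q * ?x" by simp
    with eq have "(2 * q * ?x)\<^sup>2 = 4 * q" by simp
    hence "4 * q * (q * ?x\<^sup>2) = 4 * q * 1" by (simp add: power2_eq_square algebra_simps)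
    with q True show ?thesis by simp
  qed
  thus ?thesis using q by (simp add: cmod_power2 field_simps)
qed

text \<open>
  Of the two real roots, the one of larger modulus is used. It lies inside the unit circle because
  \<open>1 - \<mu> x + q x\<^sup>2\<close> is positive at \<open>x = 1\<close> and at \<open>x = -1\<close>, and the vertex \<open>\<mu> / (2 q)\<close> lies between.
\<close>

lemma real_root_if_abs_gt:
  fixes \<mu> q :: real
  assumes q: "q > 1" and \<mu>: "\<bar>\<mu>\<bar> > 2 * sqrt q" "\<bar>\<mu>\<bar> < 1 + q"
  obtains x :: real where "1 - \<mu> * x + q * x\<^sup>2 = 0" "1 / q < \<bar>x\<bar>" "\<bar>x\<bar> < 1" "x\<^sup>2 \<noteq> 1 / q"
proof -
  define s where "s = sqrt (\<mu>\<^sup>2 - 4 * q)"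
  define y where "y = (\<bar>\<mu>\<bar> + s) / (2 * q)"
  have "(2 * sqrt q)\<^sup>2 < \<bar>\<mu>\<bar>\<^sup>2" using q \<mu> by (intro power_strict_mono) auto
  hence disc: "4 * q < \<mu>\<^sup>2" using q by (simp add: power_mult_distrib)
  hence s: "s > 0" "s\<^sup>2 = \<mu>\<^sup>2 - 4 * q" by (auto simp: s_def)
  have y: "2 * q * y = \<bar>\<mu>\<bar> + s" using q by (simp add: y_def)
  have "4 * q * (1 - \<bar>\<mu>\<bar> * y + q * y\<^sup>2) = (2 * q * y - \<bar>\<mu>\<bar>)\<^sup>2 - (\<bar>\<mu>\<bar>\<^sup>2 - 4 * q)"
    by (simp add: power2_eq_square algebra_simps)
  also have "\<dots> = 0" unfolding y using s(2) by simp
  finally have root: "1 - \<bar>\<mu>\<bar> * y + q * y\<^sup>2 = 0" using q by simp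
  have "sqrt q * sqrt q = q" using q by simp
  have "2 * q * y > 2 * sqrt q" using y \<mu>(1) s(1) by linarith
  hence lower: "q * y > sqrt q" by simp
  have "sqrt q > 1" using q by simp
  hence "q * y > 1" using lower by linarith
  hence y_lower: "1 / q < y" using q by (simp add: field_simps)
  have "(q * y)\<^sup>2 > (sqrt q)\<^sup>2" using lower q by (intro power_strict_mono) auto
  hence "q * (q * y\<^sup>2) > q * 1" using q by (simp add: power2_eq_square mult_ac)
  hence ne: "y\<^sup>2 \<noteq> 1 / q" using q by (auto simp: field_simps)
  have "s < 2 * q - \<bar>\<mu>\<bar>"
  proof (rule power2_less_imp_less)
    have "q * \<bar>\<mu>\<bar> < q * (1 + q)" using \<mu>(2) q by simp
    moreover have "(2 * q - \<bar>\<mu>\<bar>)\<^sup>2 = 4 * (q * q) - 4 * (q * \<bar>\<mu>\<bar>) + \<mu>\<^sup>2"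
      by (simp add: power2_eq_square algebra_simps)
    ultimately show "s\<^sup>2 < (2 * q - \<bar>\<mu>\<bar>)\<^sup>2" unfolding s(2) by (simp add: algebra_simps)
    show "0 \<le> 2 * q - \<bar>\<mu>\<bar>" using \<mu>(2) q by linarith
  qed
  hence "2 * q * y < 2 * q" using y by linarith
  hence y_upper: "y < 1" using q by simp
  have y0: "y > 0" using y_lower q by (smt (verit) divide_pos_pos)
  show ?thesis
  proof (cases "\<mu> \<ge> 0")
    case True
    show ?thesis by (rule that[of y]) (use True root y_lower y_upper y0 ne in auto)
  next
    case False
    show ?thesis by (rule that[of "- y"]) (use False root y_lower y_upper y0 ne in auto)
  qed
qed

section \<open>Zeros in the critical strip and the spectral bound\<close>

lemma regular_hypergraph_positive:
  assumes fin: "finite_hypergraph H" and conn: "connected_hypergraph H" and reg: "regular_hypergraph d r H"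
  shows "hverts H \<noteq> {}" "d > 0" "r > 0"
proof -
  have H: "is_hypergraph H" and f: "finite (hverts H)" "finite (hedges H)"
    using fin by (auto simp: finite_hypergraph_def)
  have "hverts H <+> hedges H \<noteq> {}"
    using conn by (simp add: connected_hypergraph_def connected_def strongly_connected_def
      mk_symmetric_def bip_graph_def)
  thus ne: "hverts H \<noteq> {}" using H by (auto simp: is_hypergraph_def)
  then obtain v where v: "v \<in> hverts H" by blast
  then obtain e where e: "e \<in> hedges H" "v \<in> ends H e" using H by (auto simp: is_hypergraph_def)
  have "card {e \<in> hedges H. v \<in> ends H e} > 0" using e f by (auto simp: card_gt_0_iff)
  thus "d > 0" using reg v by (auto simp: regular_hypergraph_def)
  have "finite (ends H e)" using e(1) f(1) H by (auto simp: is_hypergraph_def intro: finite_subset)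
  hence "card (ends H e) > 0" using e by (auto simp: card_gt_0_iff)
  thus "r > 0" using reg e by (auto simp: regular_hypergraph_def)
qed

text \<open>
  For \<open>q > 1\<close> the map \<open>s \<mapsto> q\<^bsup>-s\<^esup>\<close> takes the open strip onto the annulus and the critical line onto the
  circle of radius \<open>q\<^bsup>-1/2\<^esup>\<close>.
\<close>

lemma modified_RH_iff_roots:
  fixes H :: "('v, 'e) hypergraph"
  assumes q: "q > 1"
    and R: "to_fract [:1, of_nat r - 1:] powi (int (card (hverts H)) - int (card (hedges H))) / zeta H = to_fract p"
  shows "modified_RH H r q \<longleftrightarrow> (\<forall>u. 1 / q < cmod u \<and> cmod u < 1 \<and> poly p u = 0 \<longrightarrow> (cmod u)\<^sup>2 = 1 / q)"
proof -
  have norm: "cmod (of_real q powr (- s)) = q powr (- Re s)" for s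
    using q by (subst norm_powr_real_powr) auto
  have half: "(q powr (- x))\<^sup>2 = 1 / q \<longleftrightarrow> x = 1 / 2" for x
  proof -
    have "(q powr (- x))\<^sup>2 = q powr (- 2 * x)" using q by (simp add: power2_eq_square flip: powr_add)
    moreover have "1 / q = q powr (- 1)" using q by (simp add: powr_minus_divide)
    moreover have "q powr (- 2 * x) = q powr (- 1) \<longleftrightarrow> - 2 * x = - 1" using q by (intro powr_inj) auto
    ultimately show ?thesis by auto
  qed
  have strip: "1 / q < q powr (- x) \<longleftrightarrow> x < 1" "q powr (- x) < 1 \<longleftrightarrow> 0 < x" for x
  proof -
    have "1 / q = q powr (- 1)" using q by (simp add: powr_minus_divide)
    thus "1 / q < q powr (- x) \<longleftrightarrow> x < 1" using q by (simp only: powr_less_cancel_iff) simp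
    have "q powr (- x) < q powr 0 \<longleftrightarrow> 0 < x" using q by (simp only: powr_less_cancel_iff) simp
    thus "q powr (- x) < 1 \<longleftrightarrow> 0 < x" using q by simp
  qed
  have surj: "\<exists>s. of_real q powr (- s) = u" if "u \<noteq> 0" for u :: complex
  proof (intro exI)
    have "Ln (of_real q) \<noteq> 0" using q by (simp add: Ln_of_real)
    thus "of_real q powr (- (- Ln u / Ln (of_real q))) = u"
      using q that by (simp add: powr_def)
  qed
  have "modified_RH H r q \<longleftrightarrow> (\<forall>s. 0 < Re s \<and> Re s < 1 \<longrightarrow> poly p (of_real q powr (- s)) = 0 \<longrightarrow> Re s = 1 / 2)"
    unfolding modified_RH_def R rf_vanishes_to_fract ..
  also have "\<dots> \<longleftrightarrow> (\<forall>s. 1 / q < cmod (of_real q powr (- s)) \<and> cmod (of_real q powr (- s)) < 1 \<and>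
      poly p (of_real q powr (- s)) = 0 \<longrightarrow> (cmod (of_real q powr (- s)))\<^sup>2 = 1 / q)"
    unfolding norm half strip by (rule iff_allI) auto
  also have "\<dots> \<longleftrightarrow> (\<forall>u. 1 / q < cmod u \<and> cmod u < 1 \<and> poly p u = 0 \<longrightarrow> (cmod u)\<^sup>2 = 1 / q)"
  proof (intro iffI allI impI; (elim conjE)?)
    fix u
    assume A: "\<forall>s. 1 / q < cmod (of_real q powr (- s)) \<and> cmod (of_real q powr (- s)) < 1 \<and>
        poly p (of_real q powr (- s)) = 0 \<longrightarrow> (cmod (of_real q powr (- s)))\<^sup>2 = 1 / q"
      and u: "1 / q < cmod u" "cmod u < 1" "poly p u = 0"
    have "1 / q > 0" using q by simp
    hence "u \<noteq> 0" using u(1) by auto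
    then obtain s where "u = of_real q powr (- s)" using surj by metis
    with A u show "(cmod u)\<^sup>2 = 1 / q" by blast
  qed blast
  finally show ?thesis .
qed

text \<open>
  A hyperedge with a single hypervertex cannot be used by a closed path, so the Euler product is empty
  and the adjacency matrix is zero.
\<close>

lemma singleton_edges_modified_RH_and_ramanujan:
  fixes H :: "('v, 'e) hypergraph"
  assumes fin: "finite_hypergraph H" and conn: "connected_hypergraph H" and reg: "regular_hypergraph d 1 H"
  shows "modified_RH H 1 0" "ramanujan d 1 H"
proof -
  have single: "v = w" if e: "e \<in> hedges H" and vw: "v \<in> ends H e" "w \<in> ends H e" for e v w
  proof -
    have "card (ends H e) = 1" using reg e by (simp add: regular_hypergraph_def)
    with vw show ?thesis by (auto simp: card_1_singleton_iff)
  qed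
  have "\<not> closed_path H c" for c
  proof
    assume "closed_path H c"
    hence "c \<noteq> []" "case c ! 0 of (v, e) \<Rightarrow> case c ! (Suc 0 mod length c) of (w, f) \<Rightarrow>
        e \<in> hedges H \<and> v \<in> ends H e \<and> w \<in> ends H e \<and> v \<noteq> w"
      by (auto simp: closed_path_def Let_def case_prod_unfold)
    thus False using single by (auto simp: case_prod_unfold)
  qed
  hence "prime_cycles H = {}" by (simp add: prime_cycles_def primitive_cycle_def)
  hence "euler_product H u (inverse (poly 1 u))" for u
    unfolding euler_product_def
    by (intro tendsto_eventually eventually_finite_subsets_at_top_weakI) auto
  hence "zeta H = inverse (to_fract 1)" by (intro zeta_eq_inverse[of 1 1]) simp_all
  hence "to_fract [:1, of_nat 1 - 1:] powi (int (card (hverts H)) - int (card (hedges H))) / zeta H = to_fract 1"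
    by (simp flip: one_pCons)
  thus "modified_RH H 1 0" unfolding modified_RH_def by (simp only: rf_vanishes_to_fract) simp
  have adj: "adj_entry H v w = 0" for v w
  proof (cases "v = w")
    case False
    hence no_edge: "{e \<in> hedges H. v \<in> ends H e \<and> w \<in> ends H e} = {}" using single by blast
    show ?thesis unfolding adj_entry_eq no_edge by simp
  qed (simp add: adj_entry_eq)
  have "x = 0" if x: "x \<in> Spec H" for x
  proof -
    obtain f :: "'v \<Rightarrow> complex" where nz: "\<exists>v\<in>hverts H. f v \<noteq> 0"
      and eig: "\<And>v. v \<in> hverts H \<Longrightarrow> (\<Sum>w\<in>hverts H. of_nat (adj_entry H v w) * f w) = x * f v"
      using Spec_eigenfunction[OF fin x] by blast
    obtain v where "v \<in> hverts H" "f v \<noteq> 0" using nz by blast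
    thus ?thesis using eig[of v] by (simp add: adj)
  qed
  thus "ramanujan d 1 H" using assms by (auto simp: ramanujan_def)
qed

text \<open>
  At the lower end \<open>t = - d\<close> of the spectrum, the parameter exceeds \<open>- (1 + q)\<close> by \<open>(d - 2) (r - 2)\<close>.
\<close>

lemma spectral_parameter_bounds:
  fixes d r :: nat and t q :: real
  assumes dr: "d \<ge> r" "r \<ge> 2" and q: "q = (real d - 1) * (real r - 1)" "q \<noteq> 1"
    and t: "- real d \<le> t" "t \<le> real d * (real r - 1)"
    and nontrivial: "t \<noteq> real d * (real r - 1)" "r = 2 \<Longrightarrow> t \<noteq> - real d"
  shows "\<bar>t - real r + 2\<bar> < 1 + q"
proof -
  have top: "t - real r + 2 < 1 + q" using t nontrivial(1) unfolding q by (simp add: algebra_simps)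
  have "- (1 + q) = - real d - real r + 2 - (real d - 2) * (real r - 2)"
    unfolding q by (simp add: algebra_simps)
  moreover have "(real d - 2) * (real r - 2) \<ge> 0" using dr by simp
  moreover have "(real d - 2) * (real r - 2) > 0" if "r \<noteq> 2" using dr that by simp
  ultimately have "t - real r + 2 > - (1 + q)" using t(1) nontrivial(2) by (cases "r = 2") auto
  with top show ?thesis by linarith
qed

theorem theorem24:
  fixes H :: "('v, 'e) hypergraph" and d r :: nat and q :: real
  assumes "finite_hypergraph H" and "connected_hypergraph H" and "regular_hypergraph d r H"
    and "d \<ge> r"
    and "q = (real d - 1) * (real r - 1)"
    and "q \<noteq> 1"
    and "r = 2 \<Longrightarrow> \<not> two_colorable H"
  shows "modified_RH H r q \<longleftrightarrow> ramanujan d r H"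
proof (cases "r = 1")
  case True
  thus ?thesis using singleton_edges_modified_RH_and_ramanujan[of H d] assms by simp
next
  case False
  note fin = assms(1) and conn = assms(2) and reg = assms(3)
  note pos = regular_hypergraph_positive[OF fin conn reg]
  let ?n1 = "card (hverts H)" and ?n2 = "card (hedges H)"
  have r: "r \<ge> 2" using False pos by simp
  have "1 * 1 \<le> (real d - 1) * (real r - 1)" using r assms(4) by (intro mult_mono) auto
  hence q: "q > 1" using assms(5,6) by simp
  have n1: "?n1 > 0" using pos fin by (simp add: finite_hypergraph_def card_gt_0_iff)
  have N: "card (flags H) = ?n1 * d" "card (flags H) = ?n2 * r" by (rule card_flags[OF fin reg])+
  have "?n1 * r \<le> ?n2 * r" using N assms(4) by (metis mult_le_mono2)
  hence le: "?n1 \<le> ?n2" using r by simp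
  have "?n1 + ?n2 \<le> card (flags H)"
  proof -
    have "real r + real d < real d * real r" using q unfolding assms(5) by (simp add: algebra_simps)
    hence "r + d \<le> d * r" by (simp flip: of_nat_add of_nat_mult)
    hence "?n1 * (r + d) \<le> ?n1 * (d * r)" by (rule mult_le_mono2)
    hence "(?n1 + ?n2) * r \<le> card (flags H) * r" using N by (simp add: algebra_simps)
    thus ?thesis using r by simp
  qed
  then obtain m where m: "card (flags H) = ?n1 + ?n2 + m" using le_Suc_ex by blast
  have A: "adj_matrix H \<in> carrier_mat ?n1 ?n1" by (simp add: adj_matrix_def)
  obtain as where char: "char_poly (adj_matrix H) = (\<Prod>a\<leftarrow>as. [:- a, 1:])"
    using char_poly_factorized[OF A] by blast
  have Spec: "Spec H = set as"
    unfolding Spec_def spectrum_root_char_poly[OF A] char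
    by (auto simp: poly_prod_list prod_list_zero_iff)
  have RH: "modified_RH H r q \<longleftrightarrow> (\<forall>u. 1 / q < cmod u \<and> cmod u < 1 \<and>
      (\<exists>x\<in>Spec H. 1 - (x - of_nat r + 2) * u + of_real q * u\<^sup>2 = 0) \<longrightarrow> (cmod u)\<^sup>2 = 1 / q)"
  proof -
    have "poly (quotient_numerator d r as m) u = 0 \<longleftrightarrow>
        (\<exists>x\<in>Spec H. 1 - (x - of_nat r + 2) * u + of_real q * u\<^sup>2 = 0)" if "cmod u < 1" for u
      using that unfolding poly_quotient_numerator Spec assms(5) by (auto simp: prod_list_zero_iff image_iff)
    thus ?thesis
      unfolding modified_RH_iff_roots[OF q zeta_quotient_eq_poly[OF fin reg char le m]] by blast
  qed
  show ?thesis
  proof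
    assume rh: "modified_RH H r q"
    have "cmod (x - of_nat r + 2) \<le> 2 * sqrt q" if x: "x \<in> Spec H" "x \<noteq> of_nat d * (of_nat r - 1)" for x
    proof -
      obtain t where t: "x = of_real t" "- real d \<le> t" "t \<le> real d * (real r - 1)"
        using Spec_real_bounds[OF fin reg x(1)] by blast
      define \<mu> where "\<mu> = t - real r + 2"
      have \<mu>: "x - of_nat r + 2 = of_real \<mu>" by (simp add: \<mu>_def t)
      have "t \<noteq> real d * (real r - 1)" using x(2) t(1) by auto
      moreover have "t \<noteq> - real d" if "r = 2"
        using two_colorable_if_minus_degree_eigenvalue[of H d] fin conn reg assms(7) that x(1) t(1) by auto
      ultimately have "\<bar>\<mu>\<bar> < 1 + q"
        unfolding \<mu>_def using assms(4-6) r t by (intro spectral_parameter_bounds) auto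
      have "\<bar>\<mu>\<bar> \<le> 2 * sqrt q"
      proof (rule ccontr)
        assume "\<not> \<bar>\<mu>\<bar> \<le> 2 * sqrt q"
        hence "\<bar>\<mu>\<bar> > 2 * sqrt q" by simp
        then obtain y where y: "1 - \<mu> * y + q * y\<^sup>2 = 0" "1 / q < \<bar>y\<bar>" "\<bar>y\<bar> < 1" "y\<^sup>2 \<noteq> 1 / q"
          using real_root_if_abs_gt[OF q _ \<open>\<bar>\<mu>\<bar> < 1 + q\<close>] by blast
        have "1 - (x - of_nat r + 2) * of_real y + of_real q * (of_real y)\<^sup>2 = of_real (1 - \<mu> * y + q * y\<^sup>2)"
          unfolding \<mu> by simp
        also have "\<dots> = 0" using y(1) by simp
        finally have "(cmod (of_real y))\<^sup>2 = 1 / q"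
          using rh x(1) y(2,3) unfolding RH by (metis norm_of_real)
        with y(4) show False by simp
      qed
      thus ?thesis unfolding \<mu> by simp
    qed
    thus "ramanujan d r H" using fin conn reg assms(5) by (auto simp: ramanujan_def)
  next
    assume ram: "ramanujan d r H"
    show "modified_RH H r q"
      unfolding RH
    proof (intro allI impI, elim conjE bexE)
      fix u x
      assume u: "1 / q < cmod u" "cmod u < 1" and x: "x \<in> Spec H"
        and root: "1 - (x - of_nat r + 2) * u + of_real q * u\<^sup>2 = 0"
      show "(cmod u)\<^sup>2 = 1 / q"
      proof (cases "x = of_nat d * (of_nat r - 1)")
        case True
        have "(1 - u) * (1 - of_real q * u) = 0"
          using root unfolding True assms(5) by (simp add: power2_eq_square algebra_simps)
        hence "1 - u = 0 \<or> 1 - of_real q * u = 0" by (simp only: mult_eq_0_iff)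
        hence "cmod u = 1 \<or> q * cmod u = 1"
        proof
          assume "1 - of_real q * u = 0"
          hence "cmod (of_real q * u) = 1" by (metis norm_one right_minus_eq)
          thus ?thesis using q by (simp add: norm_mult)
        qed simp
        hence "cmod u = 1 \<or> cmod u = 1 / q" using q by (auto simp: field_simps)
        with u show ?thesis by auto
      next
        case False
        obtain t where t: "x = of_real t" using Spec_real_bounds[OF fin reg x] by blast
        have \<mu>: "x - of_nat r + 2 = of_real (t - real r + 2)" by (simp add: t)
        have "cmod (x - of_nat r + 2) \<le> 2 * sqrt q"
          using ram x False assms(4,5) by (simp add: ramanujan_def obvious_eigenvalues_def)
        hence "\<bar>t - real r + 2\<bar> \<le> 2 * sqrt q" unfolding \<mu> norm_of_real .
        thus ?thesis using root_norm_if_abs_le[of q "t - real r + 2" u] q root unfolding \<mu> by simp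
      qed
    qed
  qed
qed

end
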